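(* Let $G$ be a unimodular locally compact second countable Hausdorff topological group, $\mathcal{H}$ a separable complex Hilbert space, $U\colon G\to\mathcal{U}(\mathcal{H})$ a square integrable (irreducible) projective representation, and $\mu_G$ the Haar measure on $G$ normalized in agreement with $U$. Let $\boldsymbol{G}=G\times G$, $\mu_{\boldsymbol{G}}=\mu_G\otimes\mu_G$, let $\hat T\in\mathcal{B}_2(\mathcal{H})$ with $\|\hat T\|_{\mathcal{B}_2(\mathcal{H})}=1$, and put $\hat T(\boldsymbol{g}):=U(g_1)\hat T\,U(g_2)^*$ for $\boldsymbol{g}=(g_1,g_2)\in\boldsymbol{G}$. Let $\mathfrak{D}_{\hat T}\colon\mathcal{B}_2(\mathcal{H})\to\mathrm{L}^2(\boldsymbol{G},\mu_{\boldsymbol{G}};\mathbb{C})$ be the isometry $(\mathfrak{D}_{\hat T}\hat A)(\boldsymbol{g})=\langle\hat T(\boldsymbol{g}),\hat A\rangle_{\mathcal{B}_2(\mathcal{H})}$. Then $\mathrm{Ran}(\mathfrak{D}_{\hat T})$ is a reproducing kernel Hilbert space embedded in $\mathrm{L}^2(\boldsymbol{G},\mu_{\boldsymbol{G}};\mathbb{C})$, with reproducing kernel $$\varkappa_{\hat T}(\boldsymbol{g},\boldsymbol{g}')=\langle\hat T(\boldsymbol{g}),\hat T(\boldsymbol{g}')\rangle_{\mathcal{B}_2(\mathcal{H})};$$ that is, $\mathrm{Ran}(\mathfrak{D}_{\hat T})$ is closed and, for every $\Phi\in\mathrm{Ran}(\mathfrak{D}_{\hat T})$, $$\Phi(\boldsymbol{g})=\int_{\boldsymbol{G}}\varkappa_{\hat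 T}(\boldsymbol{g},\boldsymbol{g}')\,\Phi(\boldsymbol{g}')\;\mathrm{d}\mu_{\boldsymbol{G}}(\boldsymbol{g}')\qquad\text{for }\mu_{\boldsymbol{G}}\text{-almost all }\boldsymbol{g}\in\boldsymbol{G}.$$
   Context: Scalar products are linear in the second argument. $\mathcal{B}_2(\mathcal{H})$ is the Hilbert space of Hilbert-Schmidt operators with $\langle\hat A,\hat B\rangle_{\mathcal{B}_2(\mathcal{H})}=\mathrm{tr}(\hat A^*\hat B)$. Projective representation of $G$ in $\mathcal{H}$: a map $U\colon G\to\mathcal{U}(\mathcal{H})$ (unitary group) such that $g\mapsto\langle\phi,U(g)\psi\rangle$ is Borel for all $\phi,\psi\in\mathcal{H}$, $U(e)=I$, and $U(gh)=\mathtt{m}(g,h)U(g)U(h)$ for all $g,h\in G$, for some Borel function $\mathtt{m}\colon G\times G\to\mathbb{T}$ (the multiplier). An irreducible projective representation $U$ is square integrable if there exist nonzero $\psi,\phi\in\mathcal{H}$ with $g\mapsto\langle U(g)\psi,\phi\rangle$ in $\mathrm{L}^2(G,\mu_G;\mathbb{C})$. Known fact (Duflo-Moore): if $G$ is unimodular and $U$ is square integrable, then there is a number $d_U>0$, depending on the normalization of the Haar measure $\mu_G$, such that $\int_G\langle\phi_1,U(g)\psi_1\rangle\langle U(g)\psi_2,\phi_2\rangle\,\mathrm{d}\mu_G(g)=d_U^2\,\langle\phi_1,\phi_2\rangle\langle\psi_2,\psi_1\rangle$ for all $\phi_1,\phi_2,\psi_1,\psi_2\in\mathcal{H}$. The Haar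 measure is normalized in agreement with $U$ if $d_U=1$. "Embedded in $\mathrm{L}^2$" means that each function $\boldsymbol{g}\mapsto\langle\hat T(\boldsymbol{g}),\hat A\rangle_{\mathcal{B}_2(\mathcal{H})}$ is identified with its class modulo $\mu_{\boldsymbol{G}}$-a.e. equality. *)

theory Defs
  imports "HOL-Analysis.Analysis"
begin

section \<open>Complex Hilbert spaces\<close>

text \<open>The scalar product is linear in its second argument. The topology and the completeness
  of the space come from the norm of class \<open>banach\<close>.\<close>

class chilbert_space = banach +
  fixes scaleC :: "complex \<Rightarrow> 'a \<Rightarrow> 'a" (infixr \<open>*\<^sub>C\<close> 75)
    and cinner :: "'a \<Rightarrow> 'a \<Rightarrow> complex"
  assumes scaleC_add_right: "a *\<^sub>C (x + y) = a *\<^sub>C x + a *\<^sub>C y"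
    and scaleC_add_left: "(a + b) *\<^sub>C x = a *\<^sub>C x + b *\<^sub>C x"
    and scaleC_scaleC: "a *\<^sub>C (b *\<^sub>C x) = (a * b) *\<^sub>C x"
    and scaleC_of_real: "complex_of_real r *\<^sub>C x = r *\<^sub>R x"
    and cinner_commute: "cinner x y = cnj (cinner y x)"
    and cinner_add_right: "cinner x (y + z) = cinner x y + cinner x z"
    and cinner_scaleC_right: "cinner x (a *\<^sub>C y) = a * cinner x y"
    and cinner_self: "cinner x x = complex_of_real ((norm x)\<^sup>2)"

definition bounded_clinear :: "('a::chilbert_space \<Rightarrow> 'b::chilbert_space) \<Rightarrow> bool" where
  "bounded_clinear A \<longleftrightarrow> bounded_linear A \<and> (\<forall>c x. A (c *\<^sub>C x) = c *\<^sub>C A x)"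

definition unitary_op :: "('a::chilbert_space \<Rightarrow> 'a) \<Rightarrow> bool" where
  "unitary_op A \<longleftrightarrow>
     bounded_clinear A \<and> surj A \<and> (\<forall>x y. cinner (A x) (A y) = cinner x y)"

definition cadjoint :: "('a::chilbert_space \<Rightarrow> 'a) \<Rightarrow> 'a \<Rightarrow> 'a" where
  "cadjoint A = (THE B. \<forall>x y. cinner (A x) y = cinner x (B y))"

definition is_onb :: "'a::chilbert_space set \<Rightarrow> bool" where
  "is_onb E \<longleftrightarrow>
     (\<forall>e\<in>E. norm e = 1) \<and> (\<forall>e\<in>E. \<forall>f\<in>E. e \<noteq> f \<longrightarrow> cinner e f = 0) \<and>
     closure (module.span scaleC E) = UNIV"


section \<open>Hilbert-Schmidt operators\<close>

text \<open>The sums below do not depend on the orthonormal basis: for nonnegative terms in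
  \<open>hilbert_schmidt\<close>, and for \<open>ctrace C\<close> whenever \<open>C\<close> is trace class, in particular when
  \<open>C\<close> is a product of two Hilbert-Schmidt operators.\<close>

definition hilbert_schmidt :: "('a::chilbert_space \<Rightarrow> 'a) \<Rightarrow> bool" where
  "hilbert_schmidt A \<longleftrightarrow>
     bounded_clinear A \<and> (\<exists>E. is_onb E \<and> (\<lambda>e. (norm (A e))\<^sup>2) summable_on E)"

definition ctrace :: "('a::chilbert_space \<Rightarrow> 'a) \<Rightarrow> complex" where
  "ctrace C = (\<Sum>\<^sub>\<infinity>e\<in>(SOME E. is_onb E). cinner e (C e))"

definition hs_inner :: "('a::chilbert_space \<Rightarrow> 'a) \<Rightarrow> ('a \<Rightarrow> 'a) \<Rightarrow> complex" where
  "hs_inner A B = ctrace (cadjoint A \<circ> B)"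

definition hs_norm :: "('a::chilbert_space \<Rightarrow> 'a) \<Rightarrow> real" where
  "hs_norm A = sqrt (Re (hs_inner A A))"


section \<open>Haar measures\<close>

text \<open>Groups are written additively because the library's type classes for (not necessarily
  commutative) topological groups are additive: \<open>g + h\<close> is the product \<open>gh\<close> and \<open>0\<close> is the
  unit \<open>e\<close>. On a second countable locally compact Hausdorff space, a Borel measure that is
  finite on compact sets is automatically regular, so regularity is not listed.\<close>

definition left_haar_measure :: "'g::topological_group_add measure \<Rightarrow> bool" where
  "left_haar_measure \<mu> \<longleftrightarrow>
     sets \<mu> = sets borel \<and> emeasure \<mu> UNIV \<noteq> 0 \<and>
     (\<forall>K. compact K \<longrightarrow> emeasure \<mu> K < \<infinity>) \<and>
     (\<forall>g. \<forall>B\<in>sets borel. emeasure \<mu> ((\<lambda>x. g + x) ` B) = emeasure \<mu> B)"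

definition right_invariant :: "'g::topological_group_add measure \<Rightarrow> bool" where
  "right_invariant \<mu> \<longleftrightarrow>
     (\<forall>g. \<forall>B\<in>sets borel. emeasure \<mu> ((\<lambda>x. x + g) ` B) = emeasure \<mu> B)"

definition unimodular :: "'g::topological_group_add itself \<Rightarrow> bool" where
  "unimodular _ \<longleftrightarrow> (\<forall>\<mu>::'g measure. left_haar_measure \<mu> \<longrightarrow> right_invariant \<mu>)"


section \<open>Square integrable projective representations\<close>

definition projective_rep :: "('g::topological_group_add \<Rightarrow> 'h::chilbert_space \<Rightarrow> 'h) \<Rightarrow> bool" where
  "projective_rep U \<longleftrightarrow>
     (\<forall>g. unitary_op (U g)) \<and>
     (\<forall>\<phi> \<psi>. (\<lambda>g. cinner \<phi> (U g \<psi>)) \<in> borel_measurable borel) \<and>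
     U 0 = id \<and>
     (\<exists>m::'g \<times> 'g \<Rightarrow> complex. m \<in> borel_measurable borel \<and> (\<forall>p. norm (m p) = 1) \<and>
        (\<forall>g h \<psi>. U (g + h) \<psi> = m (g, h) *\<^sub>C U g (U h \<psi>)))"

definition irreducible_rep :: "('g \<Rightarrow> 'h::chilbert_space \<Rightarrow> 'h) \<Rightarrow> bool" where
  "irreducible_rep U \<longleftrightarrow>
     (\<exists>x::'h. x \<noteq> 0) \<and>
     (\<forall>S. module.subspace scaleC S \<and> closed S \<and> (\<forall>g. U g ` S \<subseteq> S) \<longrightarrow> S = {0} \<or> S = UNIV)"

definition L2_functions :: "'a measure \<Rightarrow> ('a \<Rightarrow> complex) set" where
  "L2_functions M = {f \<in> borel_measurable M. integrable M (\<lambda>x. (norm (f x))\<^sup>2)}"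

definition square_integrable_rep ::
    "'g::topological_group_add measure \<Rightarrow> ('g \<Rightarrow> 'h::chilbert_space \<Rightarrow> 'h) \<Rightarrow> bool" where
  "square_integrable_rep \<mu> U \<longleftrightarrow>
     projective_rep U \<and> irreducible_rep U \<and>
     (\<exists>\<psi> \<phi>. \<psi> \<noteq> 0 \<and> \<phi> \<noteq> 0 \<and> (\<lambda>g. cinner (U g \<psi>) \<phi>) \<in> L2_functions \<mu>)"

text \<open>By the Duflo-Moore theorem, a square integrable \<open>U\<close> of a unimodular group has exactly one
  \<open>d\<close> with the following property, namely \<open>d = d\<^sub>U\<close>.\<close>

definition is_duflo_moore_number ::
    "'g measure \<Rightarrow> ('g \<Rightarrow> 'h::chilbert_space \<Rightarrow> 'h) \<Rightarrow> real \<Rightarrow> bool" where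
  "is_duflo_moore_number \<mu> U d \<longleftrightarrow>
     d > 0 \<and>
     (\<forall>\<phi>1 \<phi>2 \<psi>1 \<psi>2.
        has_bochner_integral \<mu> (\<lambda>g. cinner \<phi>1 (U g \<psi>1) * cinner (U g \<psi>2) \<phi>2)
          (complex_of_real (d\<^sup>2) * cinner \<phi>1 \<phi>2 * cinner \<psi>2 \<psi>1))"

definition normalized_in_agreement ::
    "'g measure \<Rightarrow> ('g \<Rightarrow> 'h::chilbert_space \<Rightarrow> 'h) \<Rightarrow> bool" where
  "normalized_in_agreement \<mu> U \<longleftrightarrow> is_duflo_moore_number \<mu> U 1"


section \<open>The space L2 of classes modulo almost everywhere equality\<close>

definition ae_rel :: "'a measure \<Rightarrow> (('a \<Rightarrow> complex) \<times> ('a \<Rightarrow> complex)) set" where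
  "ae_rel M = {(f, h). f \<in> L2_functions M \<and> h \<in> L2_functions M \<and> (AE x in M. f x = h x)}"

definition L2 :: "'a measure \<Rightarrow> ('a \<Rightarrow> complex) set set" where
  "L2 M = L2_functions M // ae_rel M"

definition L2_class :: "'a measure \<Rightarrow> ('a \<Rightarrow> complex) \<Rightarrow> ('a \<Rightarrow> complex) set" where
  "L2_class M f = ae_rel M `` {f}"

text \<open>The integrals in \<open>L2_inner\<close> and \<open>L2_dist\<close> do not depend on the chosen representatives.\<close>

definition L2_rep :: "('a \<Rightarrow> complex) set \<Rightarrow> 'a \<Rightarrow> complex" where
  "L2_rep F = (SOME f. f \<in> F)"

definition L2_inner ::
    "'a measure \<Rightarrow> ('a \<Rightarrow> complex) set \<Rightarrow> ('a \<Rightarrow> complex) set \<Rightarrow> complex" where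
  "L2_inner M F K = (\<integral>x. cnj (L2_rep F x) * L2_rep K x \<partial>M)"

definition L2_dist ::
    "'a measure \<Rightarrow> ('a \<Rightarrow> complex) set \<Rightarrow> ('a \<Rightarrow> complex) set \<Rightarrow> real" where
  "L2_dist M F K = sqrt (\<integral>x. (norm (L2_rep F x - L2_rep K x))\<^sup>2 \<partial>M)"


section \<open>The transform and its kernel\<close>

definition That ::
    "('g \<Rightarrow> 'h::chilbert_space \<Rightarrow> 'h) \<Rightarrow> ('h \<Rightarrow> 'h) \<Rightarrow> 'g \<times> 'g \<Rightarrow> 'h \<Rightarrow> 'h" where
  "That U T g = U (fst g) \<circ> T \<circ> cadjoint (U (snd g))"

definition dequantization ::
    "'g measure \<Rightarrow> ('g \<Rightarrow> 'h::chilbert_space \<Rightarrow> 'h) \<Rightarrow> ('h \<Rightarrow> 'h) \<Rightarrow> ('h \<Rightarrow> 'h) \<Rightarrow>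
      ('g \<times> 'g \<Rightarrow> complex) set" where
  "dequantization \<mu> U T A = L2_class (\<mu> \<Otimes>\<^sub>M \<mu>) (\<lambda>g. hs_inner (That U T g) A)"

definition rep_kernel ::
    "('g \<Rightarrow> 'h::chilbert_space \<Rightarrow> 'h) \<Rightarrow> ('h \<Rightarrow> 'h) \<Rightarrow> 'g \<times> 'g \<Rightarrow> 'g \<times> 'g \<Rightarrow> complex" where
  "rep_kernel U T g g' = hs_inner (That U T g) (That U T g')"

end

theory Submission
  imports Defs
begin

text \<open>In matrix form, the transform of \<open>A\<close> is the double series over an orthonormal basis of the
  functions \<open>a\<^bsub>ef\<^esub>(g\<^sub>1, g\<^sub>2) = \<langle>U(g\<^sub>1) T e, f\<rangle> \<langle>A\<^sup>* f, U(g\<^sub>2) e\<rangle>\<close>. By Fubini and the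
  Duflo-Moore relations these are pairwise orthogonal in \<open>L\<^sup>2\<close>, with squared norms
  \<open>\<parallel>T e\<parallel>\<^sup>2 \<parallel>A\<^sup>* f\<parallel>\<^sup>2\<close>. The series converges pointwise, so Fatou's lemma identifies its pointwise sum
  with its \<open>L\<^sup>2\<close> sum, and the transform is isometric. Its range is closed because the
  Hilbert-Schmidt operators are complete. As \<open>\<kappa>(g, g')\<close> is the conjugate of the transform of
  \<open>T(g)\<close> at \<open>g'\<close>, the reproducing formula is the isometry identity for the pair \<open>T(g), A\<close>.\<close>

subsection \<open>Complex inner products\<close>

text \<open>Two choices in the definitions have to be justified before the series makes sense:
  \<open>cadjoint\<close> is a definite description, and \<open>ctrace\<close> uses an arbitrarily
  chosen basis. Adjoints of Hilbert-Schmidt operators are therefore constructed from their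
  coefficients, and basis independence comes from summing a matrix by rows and by columns. Sums over
  a basis are unordered, while Fatou's lemma and measurability of limits concern sequences.
  Separability makes the basis countable, and an exhaustion by finite sets turns the sums into
  sequential limits. Measurability of the transform, which the trace formula does not show, is then
  inherited from the partial sums. Only norms are computed along the series; scalar products follow
  by polarization. The words "almost all" in the reproducing formula are due solely to the choice of
  representative: for the concrete function given by the trace, the formula holds at every
  point.\<close>

lemma cinner_add_left: "cinner (x + y) (z::'a::chilbert_space) = cinner x z + cinner y z"
  by (metis cinner_add_right cinner_commute complex_cnj_add)

lemma cinner_scaleC_left: "cinner (a *\<^sub>C x) (y::'a::chilbert_space) = cnj a * cinner x y"
  by (metis cinner_commute cinner_scaleC_right complex_cnj_mult)

lemma cinner_scaleR_right: "cinner x (r *\<^sub>R y) = r *\<^sub>R cinner x (y::'a::chilbert_space)"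
  by (metis cinner_scaleC_right scaleC_of_real scaleR_conv_of_real)

lemma cinner_scaleR_left: "cinner (r *\<^sub>R x) y = r *\<^sub>R cinner x (y::'a::chilbert_space)"
  by (metis cinner_scaleC_left complex_cnj_complex_of_real scaleC_of_real scaleR_conv_of_real)

lemma norm_eq_cinner: "(norm (x::'a::chilbert_space))\<^sup>2 = Re (cinner x x)"
  by (simp add: cinner_self)

lemma norm_cinner_commute: "norm (cinner x y) = norm (cinner y (x::'a::chilbert_space))"
  by (metis cinner_commute complex_mod_cnj)

lemma cinner_Cauchy_Schwarz: "norm (cinner x y) \<le> norm x * norm (y::'a::chilbert_space)"
proof (cases "y = 0")
  case True
  have "cinner x (0::'a) = 0"
    using cinner_add_right[of x 0 0] by simp
  then show ?thesis using True by simp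
next
  case False
  define a where "a = complex_of_real ((norm y)\<^sup>2)"
  define b where "b = cinner y x"
  have xy: "cinner x y = cnj b"
    unfolding b_def by (rule cinner_commute)
  \<comment> \<open>\<open>z\<close> is the component of \<open>x\<close> orthogonal to
    \<open>y\<close>, multiplied by the squared norm of \<open>y\<close> to avoid a division. The
    inequality is the nonnegativity of its squared norm.\<close>
  define z where "z = a *\<^sub>C x + (- b) *\<^sub>C y"
  have "cinner z z = a * a * cinner x x - a * (b * cnj b) - a * (b * cnj b) + b * cnj b * cinner y y"
    unfolding z_def
    by (simp add: cinner_add_left cinner_add_right cinner_scaleC_left cinner_scaleC_right
        xy b_def[symmetric] a_def algebra_simps)
  also have "\<dots> = a * a * (norm x)\<^sup>2 - a * (b * cnj b)"
    unfolding cinner_self a_def by simp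
  also have "\<dots> = of_real ((norm y)\<^sup>2 * ((norm y)\<^sup>2 * (norm x)\<^sup>2 - (norm b)\<^sup>2))"
    by (simp only: a_def complex_norm_square[symmetric] of_real_mult of_real_diff
        right_diff_distrib mult.assoc)
  finally have z: "cinner z z = of_real ((norm y)\<^sup>2 * ((norm y)\<^sup>2 * (norm x)\<^sup>2 - (norm b)\<^sup>2))" .
  have "(norm z)\<^sup>2 = (norm y)\<^sup>2 * ((norm y)\<^sup>2 * (norm x)\<^sup>2 - (norm b)\<^sup>2)"
    unfolding norm_eq_cinner[of z] z Re_complex_of_real ..
  then have "0 \<le> (norm y)\<^sup>2 * ((norm y)\<^sup>2 * (norm x)\<^sup>2 - (norm b)\<^sup>2)"
    using zero_le_power2[of "norm z"] by linarith
  moreover have "0 < (norm y)\<^sup>2"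
    using False by simp
  ultimately have "(norm b)\<^sup>2 \<le> (norm x * norm y)\<^sup>2"
    unfolding power_mult_distrib mult.commute[of "(norm x)\<^sup>2"]
    by (meson diff_ge_0_iff_ge linorder_not_le mult_pos_neg)
  then have "norm b \<le> norm x * norm y"
    by (rule power2_le_imp_le) simp
  then show ?thesis
    by (simp add: xy)
qed

lemma bounded_linear_cinner_right: "bounded_linear (cinner (x::'a::chilbert_space))"
  by (rule bounded_linear_intro[where K="norm x"])
    (auto simp: cinner_add_right cinner_scaleR_right mult.commute[of _ "norm x"] cinner_Cauchy_Schwarz)

lemma bounded_linear_cinner_left: "bounded_linear (\<lambda>x. cinner x (y::'a::chilbert_space))"
  by (rule bounded_linear_intro[where K="norm y"])
    (auto simp: cinner_add_left cinner_scaleR_left cinner_Cauchy_Schwarz)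

lemmas cinner_zero_right [simp] = linear_0[OF bounded_linear.linear[OF bounded_linear_cinner_right]]
lemmas cinner_diff_right = linear_diff[OF bounded_linear.linear[OF bounded_linear_cinner_right]]
lemmas cinner_diff_left = linear_diff[OF bounded_linear.linear[OF bounded_linear_cinner_left]]
lemmas cinner_sum_right = linear_sum[OF bounded_linear.linear[OF bounded_linear_cinner_right]]
lemmas cinner_sum_left = linear_sum[OF bounded_linear.linear[OF bounded_linear_cinner_left]]

lemma cinner_eqI: "(\<And>z. cinner z x = cinner z y) \<Longrightarrow> x = (y::'a::chilbert_space)"
  using cinner_self[of "x - y"] by (simp add: cinner_diff_right)

lemma module_scaleC: "module (scaleC :: complex \<Rightarrow> 'a::chilbert_space \<Rightarrow> 'a)"
  by unfold_locales (simp_all add: scaleC_add_left scaleC_add_right scaleC_scaleC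
      scaleC_of_real[of 1, simplified])

lemma norm_scaleC: "norm (a *\<^sub>C x) = norm a * norm (x::'a::chilbert_space)"
proof -
  have "(norm (a *\<^sub>C x))\<^sup>2 = (norm a * norm x)\<^sup>2"
  proof -
    have "cinner (a *\<^sub>C x) (a *\<^sub>C x) = (a * cnj a) * cinner x x"
      by (simp only: cinner_scaleC_left cinner_scaleC_right mult.assoc mult.left_commute)
    also have "\<dots> = of_real ((norm a * norm x)\<^sup>2)"
      by (simp only: cinner_self power_mult_distrib of_real_mult complex_norm_square)
    finally show ?thesis
      by (simp only: norm_eq_cinner Re_complex_of_real)
  qed
  then show ?thesis
    using power2_eq_iff_nonneg by fastforce
qed

lemma norm_cinner_power2_le: "(norm (cinner x y))\<^sup>2 \<le> (norm x)\<^sup>2 * (norm (y::'a::chilbert_space))\<^sup>2"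
  using power_mono[OF cinner_Cauchy_Schwarz, of x y 2] by (simp add: power_mult_distrib)


subsection \<open>Orthonormal bases\<close>

lemma onb_cinner: "is_onb E \<Longrightarrow> e \<in> E \<Longrightarrow> f \<in> E \<Longrightarrow> cinner e f = (if e = f then 1 else 0)"
  by (auto simp: is_onb_def cinner_self)

lemma onb_cinner_sum:
  assumes "is_onb E" "finite F" "F \<subseteq> E" "e \<in> E"
  shows "cinner e (\<Sum>f\<in>F. c f *\<^sub>C f) = (if e \<in> F then c e else 0)"
proof -
  have "cinner e (\<Sum>f\<in>F. c f *\<^sub>C f) = (\<Sum>f\<in>F. if e = f then c f else 0)"
    unfolding cinner_sum_right
    by (rule sum.cong) (use assms onb_cinner[OF assms(1)] in \<open>auto simp: cinner_scaleC_right\<close>)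
  then show ?thesis using assms(2) by simp
qed

lemma onb_norm_sum:
  assumes "is_onb E" "finite F" "F \<subseteq> E"
  shows "(norm (\<Sum>f\<in>F. c f *\<^sub>C f))\<^sup>2 = (\<Sum>f\<in>F. (norm (c f))\<^sup>2)"
proof -
  have "cinner (\<Sum>f\<in>F. c f *\<^sub>C f) (\<Sum>f\<in>F. c f *\<^sub>C f) = (\<Sum>f\<in>F. cnj (c f) * c f)"
    unfolding cinner_sum_left cinner_scaleC_left
    by (rule sum.cong) (use assms onb_cinner_sum[OF assms] in auto)
  then show ?thesis
    by (simp only: norm_eq_cinner mult.commute[of "cnj _"] complex_norm_square[symmetric] Re_sum Re_complex_of_real)
qed

lemma onb_best_approximation:
  assumes E: "is_onb E" "finite F" "F \<subseteq> E"
  shows "norm (x - (\<Sum>e\<in>F. cinner e x *\<^sub>C e)) \<le> norm (x - (\<Sum>e\<in>F. c e *\<^sub>C e))"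
proof -
  \<comment> \<open>\<open>p\<close> is the orthogonal projection of \<open>x\<close> onto the span
    of \<open>F\<close>. Any other combination differs from it by some \<open>q\<close> in that
    span, so Pythagoras applies to \<open>x - p\<close> and \<open>q\<close>.\<close>
  define p where "p = (\<Sum>e\<in>F. cinner e x *\<^sub>C e)"
  define q where "q = (\<Sum>e\<in>F. (cinner e x - c e) *\<^sub>C e)"
  have pq: "x - (\<Sum>e\<in>F. c e *\<^sub>C e) = (x - p) + q"
    unfolding p_def q_def module.scale_left_diff_distrib[OF module_scaleC] sum_subtractf by simp
  have e: "cinner e (x - p) = 0" if "e \<in> F" for e
    using onb_cinner_sum[OF E, of e] that E by (auto simp: cinner_diff_right p_def)
  have qp: "cinner q (x - p) = 0"
    unfolding q_def cinner_sum_left cinner_scaleC_left by (simp add: e)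
  then have "cinner (x - p) q = 0"
    by (metis cinner_commute complex_cnj_zero)
  then have "(norm ((x - p) + q))\<^sup>2 = (norm (x - p))\<^sup>2 + (norm q)\<^sup>2"
    unfolding norm_eq_cinner by (simp add: cinner_add_left cinner_add_right qp)
  then have "(norm (x - p))\<^sup>2 \<le> (norm ((x - p) + q))\<^sup>2"
    by simp
  then show ?thesis
    unfolding pq p_def[symmetric] by (rule power2_le_imp_le) simp
qed

text \<open>Density of the span only yields some finite combination near \<open>x\<close>. Padded
  with zero coefficients it competes over every larger finite set, where the Fourier sum is the best
  approximation and so is at least as near.\<close>

lemma onb_expansion:
  assumes "is_onb E"
  shows "((\<lambda>e. cinner e x *\<^sub>C e) has_sum x) E"
  unfolding has_sum_def tendsto_iff
proof (intro allI impI)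
  fix \<epsilon> :: real assume "\<epsilon> > 0"
  have "x \<in> closure (module.span scaleC E)"
    using assms by (simp add: is_onb_def)
  then obtain y where y: "y \<in> module.span scaleC E" "dist y x < \<epsilon>"
    using \<open>\<epsilon> > 0\<close> unfolding closure_approachable by blast
  then obtain F c where F: "finite F" "F \<subseteq> E" "y = (\<Sum>e\<in>F. c e *\<^sub>C e)"
    unfolding module.span_explicit[OF module_scaleC] by blast
  show "\<forall>\<^sub>F G in finite_subsets_at_top E. dist (\<Sum>e\<in>G. cinner e x *\<^sub>C e) x < \<epsilon>"
    unfolding eventually_finite_subsets_at_top
  proof (intro exI[of _ F] conjI allI impI)
    fix G assume G: "finite G \<and> F \<subseteq> G \<and> G \<subseteq> E"
    define d where "d = (\<lambda>e. if e \<in> F then c e else 0)"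
    have "y = (\<Sum>e\<in>G. d e *\<^sub>C e)"
      unfolding F(3) d_def
      by (rule sum.mono_neutral_cong_left)
        (use G module.scale_zero_left[OF module_scaleC] in auto)
    then have "dist (\<Sum>e\<in>G. cinner e x *\<^sub>C e) x \<le> dist y x"
      using onb_best_approximation[of E G x d] assms G by (simp add: dist_norm norm_minus_commute)
    then show "dist (\<Sum>e\<in>G. cinner e x *\<^sub>C e) x < \<epsilon>"
      using y by simp
  qed (use F in auto)
qed

lemma Parseval_cinner:
  assumes "is_onb E"
  shows "((\<lambda>e. cinner x e * cinner e y) has_sum cinner x y) E"
  using has_sum_bounded_linear[OF bounded_linear_cinner_right onb_expansion[OF assms], of x y]
  by (simp add: cinner_scaleC_right mult.commute o_def)

lemma Parseval_norm:
  assumes "is_onb E"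
  shows "((\<lambda>e. (norm (cinner e x))\<^sup>2) has_sum (norm x)\<^sup>2) E"
proof -
  have "cinner x e * cinner e x = of_real ((norm (cinner e x))\<^sup>2)" for e
    by (subst cinner_commute[of x e]) (simp only: mult.commute[of "cnj _"] complex_norm_square)
  then have "((\<lambda>e. complex_of_real ((norm (cinner e x))\<^sup>2)) has_sum complex_of_real ((norm x)\<^sup>2)) E"
    using Parseval_cinner[OF assms, of x x] by (simp only: cinner_self)
  then show ?thesis
    by (simp only: has_sum_of_real_iff)
qed

text \<open>Distinct basis vectors have squared distance 2, hence cannot share a point of the dense
  set within 1/2 of both. Choosing such points injects the basis into a countable set.\<close>

lemma onb_countable:
  assumes sep: "separable_space (euclidean :: 'h::chilbert_space topology)"
    and E: "is_onb (E :: 'h set)"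
  shows "countable E"
proof -
  obtain C :: "'h set" where C: "countable C" "closure C = UNIV"
    using sep unfolding separable_space_def by auto
  have "\<exists>c\<in>C. dist c e < 1/2" for e
    using C(2) closure_approachable[of e C] by (metis UNIV_I half_gt_zero_iff zero_less_one)
  then obtain h where h: "\<And>e. h e \<in> C" "\<And>e. dist (h e) e < 1/2"
    by metis
  have "inj_on h E"
  proof (rule inj_onI, rule ccontr)
    fix e f assume ef: "e \<in> E" "f \<in> E" "h e = h f" "e \<noteq> f"
    have "dist e f < 1"
      using dist_triangle_half_r[of "h e" e 1 f] h(2)[of e] h(2)[of f] ef(3)
      by (metis)
    moreover have "(dist e f)\<^sup>2 = 2"
      using ef onb_cinner[OF E]
      by (simp add: dist_norm norm_eq_cinner cinner_diff_left cinner_diff_right)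
    ultimately show False
      by (smt (verit) one_power2 power_mono zero_le_dist)
  qed
  then show ?thesis
    using C(1) h(1) by (metis countable_image_inj_on countable_subset image_subset_iff)
qed

text \<open>Together with \<open>filterlim_exhaustion\<close> this passes from unordered sums to
  limits of sequences, as completeness and Fatou's lemma require.\<close>

lemma countable_exhaustion:
  assumes "countable E"
  obtains S :: "nat \<Rightarrow> 'a set"
  where "\<And>n. finite (S n)" "\<And>n. S n \<subseteq> E" "incseq S" "(\<Union>n. S n) = E"
proof
  let ?S = "\<lambda>n. {e \<in> E. to_nat_on E e < n}"
  show "finite (?S n)" for n
    by (rule inj_on_finite[where f="to_nat_on E" and B="{..<n}"])
      (use assms in \<open>auto intro: inj_on_subset[OF inj_on_to_nat_on]\<close>)
  show "incseq ?S" by (rule incseq_SucI) auto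
qed auto

lemma filterlim_exhaustion:
  assumes "\<And>n. finite (S n)" "\<And>n. S n \<subseteq> E" "incseq S" "(\<Union>n. S n) = E"
  shows "filterlim S (finite_subsets_at_top E) sequentially"
  unfolding filterlim_finite_subsets_at_top
proof (intro allI impI)
  fix X assume X: "finite X \<and> X \<subseteq> E"
  then have "finite X" "X \<subseteq> (\<Union>n. S n)"
    using assms(4) by auto
  then have "\<exists>N. X \<subseteq> S N"
  proof (induction X)
    case (insert x X)
    then obtain N n where "X \<subseteq> S N" "x \<in> S n" by auto
    then have "insert x X \<subseteq> S (max n N)"
      using incseqD[OF assms(3), of n "max n N"] incseqD[OF assms(3), of N "max n N"] by auto
    then show ?case ..
  qed auto
  then obtain N where "X \<subseteq> S N" ..
  then show "\<forall>\<^sub>F n in sequentially. finite (S n) \<and> X \<subseteq> S n \<and> S n \<subseteq> E"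
    unfolding eventually_sequentially using assms by (meson incseqD order_trans)
qed

subsection \<open>Adjoints\<close>

lemma bounded_clinear_scaleC: "bounded_clinear A \<Longrightarrow> A (c *\<^sub>C x) = c *\<^sub>C A x"
  by (simp add: bounded_clinear_def)

lemma bounded_clinear_bounded_linear: "bounded_clinear A \<Longrightarrow> bounded_linear A"
  by (simp add: bounded_clinear_def)

lemma bounded_clinear_compose:
  "bounded_clinear A \<Longrightarrow> bounded_clinear B \<Longrightarrow> bounded_clinear (A \<circ> B)"
  by (auto simp: bounded_clinear_def o_def intro: bounded_linear_compose)

lemma cadjointI:
  assumes "\<And>x y. cinner (A x) y = cinner x (B y)"
  shows "cadjoint A = B"
  unfolding cadjoint_def
proof (rule the_equality)
  fix C assume "\<forall>x y. cinner (A x) y = cinner x (C y)"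
  then show "C = B"
    using assms by (intro ext cinner_eqI) metis
qed (use assms in blast)

text \<open>Linearity is forced by nondegeneracy of the scalar product. The bound comes from writing
  the squared norm of \<open>B y\<close> as \<open>cinner (A (B y)) y\<close> and cancelling one
  factor \<open>norm (B y)\<close>.\<close>

lemma bounded_clinear_adjoint:
  assumes A: "bounded_clinear A" and adj: "\<And>x y. cinner (A x) y = cinner x (B y)"
  shows "bounded_clinear B"
proof -
  obtain K where K: "0 \<le> K" "\<And>x. norm (A x) \<le> norm x * K"
    using bounded_linear.nonneg_bounded[OF bounded_clinear_bounded_linear[OF A]] by blast
  have bound: "norm (B y) \<le> norm y * K" for y
  proof -
    have "(norm (B y))\<^sup>2 = Re (cinner (A (B y)) y)"
      by (simp add: norm_eq_cinner adj)
    also have "\<dots> \<le> norm (A (B y)) * norm y"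
      using cinner_Cauchy_Schwarz complex_Re_le_cmod order_trans by blast
    also have "\<dots> \<le> norm (B y) * K * norm y"
      by (intro mult_right_mono K) simp
    finally have "norm (B y) * norm (B y) \<le> norm (B y) * (norm y * K)"
      by (simp add: power2_eq_square algebra_simps)
    then show ?thesis
      using K(1) by (cases "B y = 0") simp_all
  qed
  have scaleC: "B (c *\<^sub>C y) = c *\<^sub>C B y" for c y
    by (rule cinner_eqI) (metis adj cinner_scaleC_right)
  show ?thesis
    unfolding bounded_clinear_def
  proof (intro conjI allI bounded_linear_intro)
    show "B (x + y) = B x + B y" for x y
      by (rule cinner_eqI) (metis adj cinner_add_right)
    show "B (r *\<^sub>R y) = r *\<^sub>R B y" for r y
      using scaleC[of "complex_of_real r"] by (simp add: scaleC_of_real)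
  qed (rule bound scaleC)+
qed

lemma Riesz_Fischer:
  fixes E :: "'h::chilbert_space set"
  assumes E: "is_onb E" and c: "(\<lambda>e. (norm (c e))\<^sup>2) summable_on E"
  obtains v where "\<And>e. e \<in> E \<Longrightarrow> cinner e v = c e"
proof -
  define E' where "E' = {e \<in> E. c e \<noteq> 0}"
  \<comment> \<open>A summable family has only countably many nonzero terms, so sequences suffice
    even when \<open>E\<close> is uncountable.\<close>
  have "countable E'"
    using abs_summable_countable[of "\<lambda>e. (norm (c e))\<^sup>2" E] c by (simp add: E'_def)
  then obtain S :: "nat \<Rightarrow> 'h set"
    where S: "\<And>n. finite (S n)" "\<And>n. S n \<subseteq> E'" "incseq S" "(\<Union>n. S n) = E'"
    using countable_exhaustion by blast
  define s where "s = (\<lambda>n. \<Sum>e\<in>S n. c e *\<^sub>C e)"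
  define g where "g = (\<lambda>n. \<Sum>e\<in>S n. (norm (c e))\<^sup>2)"
  have SE: "S n \<subseteq> E" for n
    using S(2) by (auto simp: E'_def)
  \<comment> \<open>By orthonormality, squared distances of the vector sums are distances of the
    real sums \<open>g\<close>. Hence the Cauchy property carries over from the convergent sequence
    \<open>g\<close> to \<open>s\<close>.\<close>
  have le: "(dist (s m) (s n))\<^sup>2 = dist (g m) (g n)" if "m \<le> n" for m n
  proof -
    have sub: "S m \<subseteq> S n"
      using S(3) that by (simp add: incseqD)
    have "s n - s m = (\<Sum>e\<in>S n - S m. c e *\<^sub>C e)"
      unfolding s_def by (rule sum_diff[OF S(1) sub, symmetric])
    then have "(dist (s m) (s n))\<^sup>2 = (\<Sum>e\<in>S n - S m. (norm (c e))\<^sup>2)"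
      using onb_norm_sum[OF E, of "S n - S m" c] S(1)[of n] SE[of n]
      by (simp add: dist_norm norm_minus_commute[of "s m"] subset_iff)
    also have "\<dots> = g n - g m"
      unfolding g_def by (rule sum_diff[OF S(1) sub])
    finally have "(dist (s m) (s n))\<^sup>2 = g n - g m" .
    then show ?thesis
      by (smt (verit) dist_real_def zero_le_power2)
  qed
  then have dist_eq: "(dist (s m) (s n))\<^sup>2 = dist (g m) (g n)" for m n
    by (metis dist_commute nle_le)
  have "(g \<longlongrightarrow> infsum (\<lambda>e. (norm (c e))\<^sup>2) E') sequentially"
    unfolding g_def
    by (rule filterlim_compose[OF _ filterlim_exhaustion[OF S]])
      (rule infsum_tendsto, rule summable_on_subset_banach[OF c], simp add: E'_def)
  then have "Cauchy g"
    by (rule LIMSEQ_imp_Cauchy)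
  have "Cauchy s"
    unfolding Cauchy_def
  proof (intro allI impI)
    fix \<epsilon> :: real assume "\<epsilon> > 0"
    then obtain M where "\<forall>m\<ge>M. \<forall>n\<ge>M. dist (g m) (g n) < \<epsilon>\<^sup>2"
      using \<open>Cauchy g\<close> unfolding Cauchy_def by (meson zero_less_power)
    then show "\<exists>M. \<forall>m\<ge>M. \<forall>n\<ge>M. dist (s m) (s n) < \<epsilon>"
      using \<open>\<epsilon> > 0\<close> unfolding dist_eq[symmetric] by (meson less_imp_le power2_less_imp_less)
  qed
  then obtain v where v: "s \<longlonglongrightarrow> v"
    using Cauchy_convergent convergent_def by blast
  show ?thesis
  proof (rule that)
    fix e assume e: "e \<in> E"
    have "(\<lambda>n. cinner e (s n)) \<longlonglongrightarrow> cinner e v"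
      by (rule bounded_linear.tendsto[OF bounded_linear_cinner_right v])
    moreover have "\<forall>\<^sub>F n in sequentially. cinner e (s n) = c e"
    proof (cases "c e = 0")
      case True
      then show ?thesis
        unfolding s_def using onb_cinner_sum[OF E S(1) SE e] by simp
    next
      case False
      then obtain N where "e \<in> S N"
        using S(4) e by (auto simp: E'_def)
      then have "e \<in> S n" if "n \<ge> N" for n
        using that S(3) by (meson incseqD subsetD)
      then show ?thesis
        unfolding s_def eventually_sequentially using onb_cinner_sum[OF E S(1) SE e] by metis
    qed
    ultimately have "(\<lambda>n. c e) \<longlonglongrightarrow> cinner e v"
      by (rule Lim_transform_eventually)
    then show "cinner e v = c e"
      by (simp add: LIMSEQ_const_iff)
  qed
qed

text \<open>\<open>B y\<close> is built by \<open>Riesz_Fischer\<close> from the coefficients it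
  must have, \<open>cinner (A e) y\<close>. They are square summable by Cauchy-Schwarz, because the
  squared norms of \<open>A e\<close> are summable.\<close>

lemma adjoint_exists:
  fixes A :: "'h::chilbert_space \<Rightarrow> 'h"
  assumes A: "bounded_clinear A" and E: "is_onb E" and sq: "(\<lambda>e. (norm (A e))\<^sup>2) summable_on E"
  shows "\<exists>B. \<forall>x y. cinner (A x) y = cinner x (B y)"
proof -
  have "\<exists>v. \<forall>e\<in>E. cinner e v = cinner (A e) y" for y
  proof -
    have "(\<lambda>e. (norm (A e))\<^sup>2 * (norm y)\<^sup>2) summable_on E"
      by (rule summable_on_cmult_left[OF sq])
    then have "(\<lambda>e. (norm (cinner (A e) y))\<^sup>2) summable_on E"
      by (rule summable_on_comparison_test) (auto simp: norm_cinner_power2_le)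
    then show ?thesis
      using Riesz_Fischer[OF E] by metis
  qed
  then obtain B where B: "\<And>y e. e \<in> E \<Longrightarrow> cinner e (B y) = cinner (A e) y"
    by metis
  \<comment> \<open>The relation is known on basis vectors; expanding \<open>x\<close> on the left
    and applying Parseval on the right gives the same series.\<close>
  have "cinner (A x) y = cinner x (B y)" for x y
  proof -
    have "bounded_linear (\<lambda>x. cinner (A x) y)"
      using bounded_linear_compose[OF bounded_linear_cinner_left bounded_clinear_bounded_linear[OF A]]
      by simp
    from has_sum_bounded_linear[OF this onb_expansion[OF E], of x]
    have "((\<lambda>e. cinner x e * cinner (A e) y) has_sum cinner (A x) y) E"
      by (simp add: o_def bounded_clinear_scaleC[OF A] cinner_scaleC_left cinner_commute[of x])
    moreover have "((\<lambda>e. cinner x e * cinner (A e) y) has_sum cinner x (B y)) E"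
      using Parseval_cinner[OF E, of x "B y"] B by (simp cong: has_sum_cong)
    ultimately show ?thesis
      by (rule has_sum_unique)
  qed
  then show ?thesis by blast
qed


subsection \<open>Hilbert-Schmidt operators\<close>

text \<open>Tonelli for the squared matrix entries: summing over \<open>f\<close> first gives the
  norms of \<open>A e\<close>, summing over \<open>e\<close> first those of \<open>B f\<close>.
  Allowing a second basis \<open>F\<close> makes this the source of basis independence.\<close>

lemma adjoint_norm_has_sum:
  fixes A :: "'h::chilbert_space \<Rightarrow> 'h"
  assumes E: "is_onb E" and F: "is_onb F"
    and adj: "\<And>x y. cinner (A x) y = cinner x (B y)"
    and sq: "((\<lambda>e. (norm (A e))\<^sup>2) has_sum s) E"
  shows "((\<lambda>(e, f). (norm (cinner f (A e)))\<^sup>2) has_sum s) (E \<times> F)"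
    and "((\<lambda>f. (norm (B f))\<^sup>2) has_sum s) F"
proof -
  have "(\<lambda>(e, f). (norm (cinner f (A e)))\<^sup>2) summable_on (E \<times> F)"
    by (rule summable_on_SigmaI[where g="\<lambda>e. (norm (A e))\<^sup>2"])
      (use Parseval_norm[OF F] sq in \<open>auto simp: has_sum_imp_summable\<close>)
  then show *: "((\<lambda>(e, f). (norm (cinner f (A e)))\<^sup>2) has_sum s) (E \<times> F)"
    by (intro has_sum_SigmaI[where g="\<lambda>e. (norm (A e))\<^sup>2"])
      (use Parseval_norm[OF F] sq in auto)
  have "norm (cinner f (A e)) = norm (cinner e (B f))" for e f
    by (metis adj norm_cinner_commute)
  then have "((\<lambda>(f, e). (norm (cinner e (B f)))\<^sup>2) has_sum s) (F \<times> E)"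
    using * by (subst (asm) has_sum_swap) simp
  then show "((\<lambda>f. (norm (B f))\<^sup>2) has_sum s) F"
    by (rule has_sum_SigmaD) (use Parseval_norm[OF E] in auto)
qed

lemma hilbert_schmidt_bounded_clinear: "hilbert_schmidt A \<Longrightarrow> bounded_clinear A"
  by (simp add: hilbert_schmidt_def)

lemma cinner_cadjoint_right:
  assumes "hilbert_schmidt A"
  shows "cinner (A x) y = cinner x (cadjoint A y)"
  using assms adjoint_exists cadjointI unfolding hilbert_schmidt_def by metis

lemma cinner_cadjoint_left:
  assumes "hilbert_schmidt A"
  shows "cinner (cadjoint A x) y = cinner x (A y)"
  by (metis cinner_cadjoint_right[OF assms] cinner_commute)

lemma hilbert_schmidt_cadjoint:
  assumes "hilbert_schmidt A"
  shows "hilbert_schmidt (cadjoint A)"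
proof -
  obtain E where E: "is_onb E" "(\<lambda>e. (norm (A e))\<^sup>2) summable_on E"
    using assms by (auto simp: hilbert_schmidt_def)
  then show ?thesis
    using adjoint_norm_has_sum(2)[OF E(1) E(1) cinner_cadjoint_right[OF assms] has_sum_infsum[OF E(2)]]
      bounded_clinear_adjoint[OF hilbert_schmidt_bounded_clinear[OF assms] cinner_cadjoint_right[OF assms]]
    unfolding hilbert_schmidt_def by (metis has_sum_imp_summable)
qed

text \<open>The definition provides one basis only. It provides one for the adjoint too, and passing
  from the adjoint back to \<open>A\<close> lands in any prescribed basis.\<close>

lemma hilbert_schmidt_summable:
  fixes A :: "'h::chilbert_space \<Rightarrow> 'h"
  assumes A: "hilbert_schmidt A" and F: "is_onb F"
  shows "(\<lambda>f. (norm (A f))\<^sup>2) summable_on F"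
proof -
  obtain E where E: "is_onb E" "(\<lambda>e. (norm (cadjoint A e))\<^sup>2) summable_on E"
    using hilbert_schmidt_cadjoint[OF A] by (auto simp: hilbert_schmidt_def)
  show ?thesis
    using adjoint_norm_has_sum(2)[OF E(1) F cinner_cadjoint_left[OF A] has_sum_infsum[OF E(2)]]
    by (rule has_sum_imp_summable)
qed

lemma hilbert_schmidt_iff:
  "is_onb E \<Longrightarrow> hilbert_schmidt A \<longleftrightarrow> bounded_clinear A \<and> (\<lambda>e. (norm (A e))\<^sup>2) summable_on E"
  using hilbert_schmidt_summable hilbert_schmidt_def by blast

lemma hilbert_schmidt_onb: "hilbert_schmidt (A :: 'h \<Rightarrow> 'h) \<Longrightarrow> \<exists>E :: 'h::chilbert_space set. is_onb E"
  by (auto simp: hilbert_schmidt_def)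

text \<open>Since \<open>a * b\<close> is at most the sum of the squares, the products of matrix
  entries are absolutely summable. Summing by rows and by columns then gives the same value
  \<open>s\<close>.\<close>

lemma hilbert_schmidt_matrix_sum:
  fixes A B :: "'h::chilbert_space \<Rightarrow> 'h"
  assumes A: "hilbert_schmidt A" and B: "hilbert_schmidt B" and E: "is_onb E" and F: "is_onb F"
  obtains s where "((\<lambda>(e, f). cinner (A e) f * cinner f (B e)) has_sum s) (E \<times> F)"
    and "((\<lambda>e. cinner (A e) (B e)) has_sum s) E"
    and "((\<lambda>f. cinner (cadjoint B f) (cadjoint A f)) has_sum s) F"
proof -
  let ?f = "\<lambda>(e, f). cinner (A e) f * cinner f (B e)"
  have sq: "(\<lambda>(e, f). (norm (cinner f (C e)))\<^sup>2) summable_on (E \<times> F)"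
    if "hilbert_schmidt C" for C :: "'h \<Rightarrow> 'h"
    using adjoint_norm_has_sum(1)[OF E F cinner_cadjoint_right[OF that]
        has_sum_infsum[OF hilbert_schmidt_summable[OF that E]]]
    by (rule has_sum_imp_summable)
  have "(\<lambda>p. (norm (cinner (snd p) (A (fst p))))\<^sup>2 + (norm (cinner (snd p) (B (fst p))))\<^sup>2)
      summable_on (E \<times> F)"
    using summable_on_add[OF sq[OF A] sq[OF B]] by (simp add: case_prod_beta)
  then have "(\<lambda>p. norm (?f p)) summable_on (E \<times> F)"
  proof (rule Infinite_Sum.abs_summable_on_comparison_test')
    fix p
    have ab: "a * b \<le> a\<^sup>2 + b\<^sup>2" if "0 \<le> a" "0 \<le> b" for a b :: real
      using sum_squares_bound[of a b] mult_nonneg_nonneg[OF that] by linarith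
    show "norm (?f p) \<le>
        (norm (cinner (snd p) (A (fst p))))\<^sup>2 + (norm (cinner (snd p) (B (fst p))))\<^sup>2"
      using ab[OF norm_ge_zero norm_ge_zero]
      by (simp add: case_prod_beta norm_mult norm_cinner_commute[of "A (fst p)"])
  qed
  then have s: "(?f has_sum infsum ?f (E \<times> F)) (E \<times> F)"
    using abs_summable_summable has_sum_infsum by blast
  show ?thesis
  proof (rule that[OF s])
    show "((\<lambda>e. cinner (A e) (B e)) has_sum infsum ?f (E \<times> F)) E"
      by (rule has_sum_SigmaD[OF s]) (simp add: Parseval_cinner[OF F])
    have "((\<lambda>(f, e). cinner (cadjoint B f) e * cinner e (cadjoint A f)) has_sum infsum ?f (E \<times> F)) (F \<times> E)"
      using s by (subst (asm) has_sum_swap)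
        (simp add: cinner_cadjoint_left[OF B] cinner_cadjoint_right[OF A] mult.commute)
    then show "((\<lambda>f. cinner (cadjoint B f) (cadjoint A f)) has_sum infsum ?f (E \<times> F)) F"
      by (rule has_sum_SigmaD) (simp add: Parseval_cinner[OF E])
  qed
qed

text \<open>Passing to adjoints twice shows that the sum defining \<open>hs_inner\<close> does not depend on the basis.\<close>

lemma hs_inner_has_sum:
  fixes A B :: "'h::chilbert_space \<Rightarrow> 'h"
  assumes A: "hilbert_schmidt A" and B: "hilbert_schmidt B" and E: "is_onb E" and F: "is_onb F"
  shows "((\<lambda>e. cinner (A e) (B e)) has_sum hs_inner A B) E"
    and "((\<lambda>(e, f). cinner (A e) f * cinner f (B e)) has_sum hs_inner A B) (E \<times> F)"
    and "((\<lambda>e. cinner (cadjoint B e) (cadjoint A e)) has_sum hs_inner A B) E"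
proof -
  define E0 where "E0 = (SOME E :: 'h set. is_onb E)"
  have E0: "is_onb E0"
    unfolding E0_def by (rule someI[where P=is_onb, OF E])
  have hs: "hs_inner A B = infsum (\<lambda>e. cinner (A e) (B e)) E0"
    unfolding hs_inner_def ctrace_def E0_def[symmetric] by (simp add: cinner_cadjoint_right[OF A])
  obtain s where s: "((\<lambda>e. cinner (A e) (B e)) has_sum s) E0"
    "((\<lambda>f. cinner (cadjoint B f) (cadjoint A f)) has_sum s) E"
    by (rule hilbert_schmidt_matrix_sum[OF A B E0 E])
  obtain s' where s': "((\<lambda>e. cinner (A e) (B e)) has_sum s') E"
    "((\<lambda>f. cinner (cadjoint B f) (cadjoint A f)) has_sum s') E"
    by (rule hilbert_schmidt_matrix_sum[OF A B E E])
  obtain s'' where s'': "((\<lambda>e. cinner (A e) (B e)) has_sum s'') E"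
    "((\<lambda>(e, f). cinner (A e) f * cinner f (B e)) has_sum s'') (E \<times> F)"
    by (rule hilbert_schmidt_matrix_sum[OF A B E F])
  \<comment> \<open>The chain runs as follows: \<open>s\<close> is the sum over the basis of
    \<open>ctrace\<close>, it meets \<open>s'\<close> in the adjoint sum over \<open>E\<close>, and
    \<open>s'\<close> meets \<open>s''\<close> in the direct sum over \<open>E\<close>.\<close>
  have eq: "s = hs_inner A B" "s' = s" "s'' = s'"
    using s s' s'' hs has_sum_unique infsumI by metis+
  show "((\<lambda>e. cinner (A e) (B e)) has_sum hs_inner A B) E"
    "((\<lambda>(e, f). cinner (A e) f * cinner f (B e)) has_sum hs_inner A B) (E \<times> F)"
    "((\<lambda>e. cinner (cadjoint B e) (cadjoint A e)) has_sum hs_inner A B) E"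
    using s s' s'' eq by simp_all
qed

section \<open>Linear structure and scalar product of Hilbert-Schmidt operators\<close>

lemma norm_add_power2_le: "(norm (x + y :: 'a::real_normed_vector))\<^sup>2 \<le> 2 * (norm x)\<^sup>2 + 2 * (norm y)\<^sup>2"
proof -
  have "(norm (x + y))\<^sup>2 \<le> (norm x + norm y)\<^sup>2"
    by (rule power_mono[OF norm_triangle_ineq]) simp
  also have "\<dots> \<le> 2 * (norm x)\<^sup>2 + 2 * (norm y)\<^sup>2"
    using sum_squares_bound[of "norm x" "norm y"] by (simp add: power2_sum)
  finally show ?thesis .
qed

lemma bounded_clinear_add:
  assumes "bounded_clinear A" "bounded_clinear B"
  shows "bounded_clinear (\<lambda>x. A x + B x)"
  using assms by (auto simp: bounded_clinear_def scaleC_add_right intro: bounded_linear_add)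

lemma bounded_linear_scaleC_left: "bounded_linear (\<lambda>x. c *\<^sub>C (x::'a::chilbert_space))"
proof (rule bounded_linear_intro[where K="norm c"])
  show "c *\<^sub>C (r *\<^sub>R x) = r *\<^sub>R c *\<^sub>C x" for r and x :: 'a
    by (metis mult.commute scaleC_of_real scaleC_scaleC)
qed (simp_all add: scaleC_add_right norm_scaleC)

lemma bounded_clinear_scale:
  assumes "bounded_clinear A"
  shows "bounded_clinear (\<lambda>x. c *\<^sub>C A x)"
  using assms bounded_linear_compose[OF bounded_linear_scaleC_left]
  by (auto simp: bounded_clinear_def scaleC_scaleC mult.commute)

lemma hilbert_schmidt_add:
  fixes A :: "'a::chilbert_space \<Rightarrow> 'a"
  assumes A: "hilbert_schmidt A" and B: "hilbert_schmidt B"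
  shows "hilbert_schmidt (\<lambda>x. A x + B x)"
proof -
  obtain E :: "'a set" where E: "is_onb E"
    using A hilbert_schmidt_onb by blast
  have "(\<lambda>e. 2 * (norm (A e))\<^sup>2 + 2 * (norm (B e))\<^sup>2) summable_on E"
    by (intro summable_on_add summable_on_cmult_right hilbert_schmidt_summable[OF A E]
        hilbert_schmidt_summable[OF B E])
  then have "(\<lambda>e. (norm (A e + B e))\<^sup>2) summable_on E"
    by (rule summable_on_comparison_test) (auto simp: norm_add_power2_le)
  then show ?thesis
    using A B hilbert_schmidt_iff[OF E] bounded_clinear_add by blast
qed

lemma hilbert_schmidt_scale:
  fixes A :: "'a::chilbert_space \<Rightarrow> 'a"
  assumes A: "hilbert_schmidt A"
  shows "hilbert_schmidt (\<lambda>x. c *\<^sub>C A x)"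
proof -
  obtain E :: "'a set" where E: "is_onb E"
    using A hilbert_schmidt_onb by blast
  have "(\<lambda>e. (norm (c *\<^sub>C A e))\<^sup>2) summable_on E"
    unfolding norm_scaleC power_mult_distrib
    by (intro summable_on_cmult_right hilbert_schmidt_summable[OF A E])
  then show ?thesis
    using A hilbert_schmidt_iff[OF E] bounded_clinear_scale by blast
qed

lemma diff_conv_scaleC: "x - y = x + (- 1) *\<^sub>C (y::'a::chilbert_space)"
  using scaleC_of_real[of "- 1" y] by simp

lemma hilbert_schmidt_diff:
  "hilbert_schmidt A \<Longrightarrow> hilbert_schmidt B \<Longrightarrow> hilbert_schmidt (\<lambda>x. A x - B x)"
  unfolding diff_conv_scaleC by (intro hilbert_schmidt_add hilbert_schmidt_scale)

lemma hs_inner_commute: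
  fixes A :: "'a::chilbert_space \<Rightarrow> 'a"
  assumes A: "hilbert_schmidt A" and B: "hilbert_schmidt B"
  shows "hs_inner A B = cnj (hs_inner B A)"
proof -
  obtain E :: "'a set" where E: "is_onb E"
    using A hilbert_schmidt_onb by blast
  have "((\<lambda>e. cnj (cinner (B e) (A e))) has_sum cnj (hs_inner B A)) E"
    unfolding has_sum_cnj_iff by (rule hs_inner_has_sum(1)[OF B A E E])
  then show ?thesis
    unfolding cinner_commute[symmetric]
    by (rule has_sum_unique[OF hs_inner_has_sum(1)[OF A B E E]])
qed

lemma hs_inner_add_right:
  fixes A :: "'a::chilbert_space \<Rightarrow> 'a"
  assumes A: "hilbert_schmidt A" and B: "hilbert_schmidt B" and C: "hilbert_schmidt C"
  shows "hs_inner A (\<lambda>x. B x + C x) = hs_inner A B + hs_inner A C"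
proof -
  obtain E :: "'a set" where E: "is_onb E"
    using A hilbert_schmidt_onb by blast
  have "((\<lambda>e. cinner (A e) (B e + C e)) has_sum hs_inner A B + hs_inner A C) E"
    unfolding cinner_add_right
    by (intro has_sum_add hs_inner_has_sum(1)[OF A B E E] hs_inner_has_sum(1)[OF A C E E])
  then show ?thesis
    using has_sum_unique hs_inner_has_sum(1)[OF A hilbert_schmidt_add[OF B C] E E] by blast
qed

lemma hs_inner_scale_right:
  fixes A :: "'a::chilbert_space \<Rightarrow> 'a"
  assumes A: "hilbert_schmidt A" and B: "hilbert_schmidt B"
  shows "hs_inner A (\<lambda>x. c *\<^sub>C B x) = c * hs_inner A B"
proof -
  obtain E :: "'a set" where E: "is_onb E"
    using A hilbert_schmidt_onb by blast
  have "((\<lambda>e. cinner (A e) (c *\<^sub>C B e)) has_sum c * hs_inner A B) E"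
    unfolding cinner_scaleC_right
    by (intro has_sum_cmult_right hs_inner_has_sum(1)[OF A B E E])
  then show ?thesis
    using has_sum_unique hs_inner_has_sum(1)[OF A hilbert_schmidt_scale[OF B] E E] by blast
qed

lemma hs_inner_add_left:
  assumes "hilbert_schmidt A" "hilbert_schmidt B" "hilbert_schmidt C"
  shows "hs_inner (\<lambda>x. A x + B x) C = hs_inner A C + hs_inner B C"
  using assms hs_inner_add_right[OF assms(3,1,2)] hs_inner_commute hilbert_schmidt_add
  by (metis complex_cnj_add)

lemma hs_inner_scale_left:
  assumes "hilbert_schmidt A" "hilbert_schmidt B"
  shows "hs_inner (\<lambda>x. c *\<^sub>C A x) B = cnj c * hs_inner A B"
  using assms hs_inner_scale_right[OF assms(2,1)] hs_inner_commute hilbert_schmidt_scale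
  by (metis complex_cnj_mult)

lemma hs_inner_diff_right:
  assumes "hilbert_schmidt A" "hilbert_schmidt B" "hilbert_schmidt C"
  shows "hs_inner A (\<lambda>x. B x - C x) = hs_inner A B - hs_inner A C"
  unfolding diff_conv_scaleC
  by (simp add: hs_inner_add_right hs_inner_scale_right assms hilbert_schmidt_scale)

lemma hs_inner_self_has_sum:
  assumes A: "hilbert_schmidt A" and E: "is_onb E"
  shows "((\<lambda>e. (norm (A e))\<^sup>2) has_sum Re (hs_inner A A)) E"
  using has_sum_Re[OF hs_inner_has_sum(1)[OF A A E E]] by (simp only: norm_eq_cinner)

lemma hs_inner_self_nonneg:
  fixes A :: "'a::chilbert_space \<Rightarrow> 'a"
  assumes A: "hilbert_schmidt A"
  shows "0 \<le> Re (hs_inner A A)"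
proof -
  obtain E :: "'a set" where E: "is_onb E"
    using A hilbert_schmidt_onb by blast
  show ?thesis
    by (rule has_sum_nonneg[OF hs_inner_self_has_sum[OF A E]]) simp
qed

lemma hs_inner_self_cadjoint:
  assumes A: "hilbert_schmidt A" and E: "is_onb E"
  shows "((\<lambda>e. (norm (cadjoint A e))\<^sup>2) has_sum Re (hs_inner A A)) E"
  using adjoint_norm_has_sum(2)[OF E E cinner_cadjoint_right[OF A] hs_inner_self_has_sum[OF A E]] .

text \<open>Each coefficient of \<open>A x\<close> is the product of \<open>x\<close> with
  \<open>cadjoint A e\<close>; apply Cauchy-Schwarz and sum over \<open>e\<close>. This domination
  makes Hilbert-Schmidt Cauchy sequences converge pointwise.\<close>

lemma norm_le_hs:
  fixes A :: "'a::chilbert_space \<Rightarrow> 'a"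
  assumes A: "hilbert_schmidt A"
  shows "(norm (A x))\<^sup>2 \<le> Re (hs_inner A A) * (norm x)\<^sup>2"
proof -
  obtain E :: "'a set" where E: "is_onb E"
    using A hilbert_schmidt_onb by blast
  have "(norm (cinner e (A x)))\<^sup>2 \<le> (norm (cadjoint A e))\<^sup>2 * (norm x)\<^sup>2" for e
    unfolding cinner_cadjoint_left[OF A, symmetric] by (rule norm_cinner_power2_le)
  then show ?thesis
    using has_sum_mono[OF Parseval_norm[OF E] has_sum_cmult_left[OF hs_inner_self_cadjoint[OF A E]]]
    by blast
qed


subsection \<open>Unitary operators\<close>

lemma unitary_cadjoint:
  assumes U: "unitary_op U"
  shows "cinner (U x) y = cinner x (cadjoint U y)"
    and "cinner (cadjoint U x) y = cinner x (U y)"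
    and "bounded_clinear (cadjoint U)"
    and "norm (U x) = norm x"
    and "hilbert_schmidt A \<Longrightarrow> hilbert_schmidt (U \<circ> A)"
    and "hilbert_schmidt A \<Longrightarrow> hilbert_schmidt (A \<circ> U)"
    and "hilbert_schmidt A \<Longrightarrow> hilbert_schmidt (A \<circ> cadjoint U)"
proof -
  have bU: "bounded_clinear U" and U_inner: "cinner (U x) (U y) = cinner x y" and "surj U" for x y
    using U by (auto simp: unitary_op_def)
  then have adj: "cinner (U x) y = cinner x (inv U y)" for x y
    by (metis surj_f_inv_f)
  then have cadj: "cadjoint U = inv U"
    by (rule cadjointI)
  have adj1: "cinner (U x) y = cinner x (cadjoint U y)" for x y
    unfolding cadj by (rule adj)
  have adj2: "cinner (cadjoint U x) y = cinner x (U y)" for x y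
    by (metis adj1 cinner_commute)
  have bV: "bounded_clinear (cadjoint U)"
    by (rule bounded_clinear_adjoint[OF bU adj1])
  have norm_U: "norm (U x) = norm x" for x
    using norm_eq_cinner[of "U x"] norm_eq_cinner[of x] U_inner[of x x]
    by (metis norm_ge_zero power2_eq_imp_eq)
  have "U (cadjoint U y) = y" for y
    using \<open>surj U\<close> by (simp add: cadj surj_f_inv_f)
  then have norm_V: "norm (cadjoint U y) = norm y" for y
    by (metis norm_U)
  have UA: "hilbert_schmidt (W \<circ> A)"
    if "hilbert_schmidt A" "bounded_clinear W" "\<And>x. norm (W x) = norm x" for W A :: "'a \<Rightarrow> 'a"
    using that bounded_clinear_compose unfolding hilbert_schmidt_def by auto
  \<comment> \<open>Composition on the right changes the vectors to which \<open>A\<close> is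
    applied, so norms cannot be compared termwise. On adjoints it becomes composition with an
    isometry on the left, which \<open>UA\<close> handles.\<close>
  have AU: "hilbert_schmidt (A \<circ> V)"
    if A: "hilbert_schmidt A" and W: "bounded_clinear W" "\<And>x. norm (W x) = norm x"
      "\<And>x y. cinner (V x) y = cinner x (W y)" for V W A :: "'a \<Rightarrow> 'a"
  proof -
    have W': "cinner (W x) y = cinner x (V y)" for x y
      using W(3) cinner_commute by metis
    have "cadjoint (W \<circ> cadjoint A) = A \<circ> V"
      by (rule cadjointI) (simp add: W' cinner_cadjoint_left[OF A])
    then show ?thesis
      using hilbert_schmidt_cadjoint[OF UA[OF hilbert_schmidt_cadjoint[OF A] W(1,2)]] by simp
  qed
  show "hilbert_schmidt A \<Longrightarrow> hilbert_schmidt (U \<circ> A)"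
    by (rule UA[OF _ bU norm_U])
  show "hilbert_schmidt A \<Longrightarrow> hilbert_schmidt (A \<circ> U)"
    by (rule AU[OF _ bV norm_V adj1])
  show "hilbert_schmidt A \<Longrightarrow> hilbert_schmidt (A \<circ> cadjoint U)"
    by (rule AU[OF _ bU norm_U adj2])
  show "cinner (U x) y = cinner x (cadjoint U y)" "cinner (cadjoint U x) y = cinner x (U y)"
    "bounded_clinear (cadjoint U)" "norm (U x) = norm x"
    by (rule adj1 adj2 bV norm_U)+
qed

text \<open>An instance of cyclicity of the trace. In the adjoint form of the sum,
  \<open>hs_inner_has_sum(3)\<close>, both sides are the same series.\<close>

lemma hs_inner_unitary_compose:
  fixes A :: "'a::chilbert_space \<Rightarrow> 'a"
  assumes X: "hilbert_schmidt X" and A: "hilbert_schmidt A" and U: "unitary_op U"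
  shows "hs_inner (X \<circ> cadjoint U) A = hs_inner X (A \<circ> U)"
proof -
  obtain E :: "'a set" where E: "is_onb E"
    using A hilbert_schmidt_onb by blast
  have XU: "cadjoint (X \<circ> cadjoint U) = U \<circ> cadjoint X"
    by (rule cadjointI) (simp add: unitary_cadjoint[OF U] cinner_cadjoint_right[OF X])
  have AU: "cadjoint (A \<circ> U) = cadjoint U \<circ> cadjoint A"
    by (rule cadjointI) (simp add: unitary_cadjoint[OF U] cinner_cadjoint_right[OF A])
  have "((\<lambda>e. cinner (cadjoint A e) (U (cadjoint X e))) has_sum hs_inner (X \<circ> cadjoint U) A) E"
    using hs_inner_has_sum(3)[OF unitary_cadjoint(7)[OF U X] A E E] by (simp add: XU)
  moreover have "((\<lambda>e. cinner (cadjoint A e) (U (cadjoint X e))) has_sum hs_inner X (A \<circ> U)) E"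
    using hs_inner_has_sum(3)[OF X unitary_cadjoint(6)[OF U A] E E]
    by (simp add: AU unitary_cadjoint(2)[OF U])
  ultimately show ?thesis
    by (rule has_sum_unique)
qed

lemma hilbert_schmidt_That:
  assumes "\<And>g. unitary_op (U g)" and "hilbert_schmidt T"
  shows "hilbert_schmidt (That U T g)"
  unfolding That_def
  by (intro unitary_cadjoint(7)[OF assms(1)] unitary_cadjoint(5)[OF assms(1)] assms(2))

text \<open>Moving the second unitary to the side of \<open>A\<close> makes every term a function of
  \<open>fst g\<close> times a function of \<open>snd g\<close>, which is what Fubini needs.\<close>

lemma hs_inner_That_has_sum:
  assumes U: "\<And>g. unitary_op (U g)" and T: "hilbert_schmidt T" and A: "hilbert_schmidt A"
    and E: "is_onb E"
  shows "((\<lambda>(e, f). cinner (U (fst g) (T e)) f * cinner (cadjoint A f) (U (snd g) e))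
    has_sum hs_inner (That U T g) A) (E \<times> E)"
proof -
  have "hs_inner (That U T g) A = hs_inner (U (fst g) \<circ> T) (A \<circ> U (snd g))"
    unfolding That_def
    by (rule hs_inner_unitary_compose[OF unitary_cadjoint(5)[OF U T] A U])
  then show ?thesis
    using hs_inner_has_sum(2)[OF unitary_cadjoint(5)[OF U T] unitary_cadjoint(6)[OF U A] E E]
    by (simp add: cinner_cadjoint_left[OF A])
qed

subsection \<open>Square integrable functions\<close>

lemma L2_functionsD:
  assumes "f \<in> L2_functions M"
  shows "f \<in> borel_measurable M" "integrable M (\<lambda>x. (norm (f x))\<^sup>2)"
  using assms by (auto simp: L2_functions_def)

lemma L2_functions_add:
  assumes "f \<in> L2_functions M" "h \<in> L2_functions M"
  shows "(\<lambda>x. f x + h x) \<in> L2_functions M"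
proof -
  note [measurable] = L2_functionsD(1)[OF assms(1)] L2_functionsD(1)[OF assms(2)]
  have "integrable M (\<lambda>x. 2 * (norm (f x))\<^sup>2 + 2 * (norm (h x))\<^sup>2)"
    using assms by (intro Bochner_Integration.integrable_add integrable_mult_right L2_functionsD)
  then have "integrable M (\<lambda>x. (norm (f x + h x))\<^sup>2)"
    by (rule Bochner_Integration.integrable_bound) (auto simp: norm_add_power2_le)
  then show ?thesis
    by (simp add: L2_functions_def)
qed

lemma L2_functions_mult:
  assumes "f \<in> L2_functions M"
  shows "(\<lambda>x. c * f x) \<in> L2_functions M"
  using assms by (auto simp: L2_functions_def norm_mult power_mult_distrib)

lemma L2_functions_diff:
  assumes "f \<in> L2_functions M" "h \<in> L2_functions M"
  shows "(\<lambda>x. f x - h x) \<in> L2_functions M"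
  using L2_functions_add[OF assms(1) L2_functions_mult[OF assms(2), of "- 1"]] by simp

lemma borel_measurable_cnj [measurable]: "f \<in> borel_measurable M \<Longrightarrow> (\<lambda>x. cnj (f x)) \<in> borel_measurable M"
  using measurable_compose borel_measurable_continuous_onI linear_continuous_on[OF bounded_linear_cnj]
  by blast

lemma L2_functions_cnj_mult_integrable:
  assumes "f \<in> L2_functions M" "h \<in> L2_functions M"
  shows "integrable M (\<lambda>x. cnj (f x) * h x)"
proof -
  note [measurable] = L2_functionsD(1)[OF assms(1)] L2_functionsD(1)[OF assms(2)]
  have ab: "a * b \<le> a\<^sup>2 + b\<^sup>2" if "0 \<le> a" "0 \<le> b" for a b :: real
    using sum_squares_bound[of a b] mult_nonneg_nonneg[OF that] by linarith
  have "integrable M (\<lambda>x. (norm (f x))\<^sup>2 + (norm (h x))\<^sup>2)"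
    using assms by (intro Bochner_Integration.integrable_add L2_functionsD)
  then show ?thesis
    by (rule Bochner_Integration.integrable_bound) (auto simp: norm_mult ab)
qed

text \<open>Estimates are made on functions; \<open>L2_dist_class\<close> transfers them to
  classes.\<close>

definition l2_norm :: "'a measure \<Rightarrow> ('a \<Rightarrow> complex) \<Rightarrow> real" where
  "l2_norm M f = sqrt (\<integral>x. (norm (f x))\<^sup>2 \<partial>M)"

lemma l2_norm_nonneg: "0 \<le> l2_norm M f"
  by (simp add: l2_norm_def)

lemma l2_norm_power2: "(l2_norm M f)\<^sup>2 = (\<integral>x. (norm (f x))\<^sup>2 \<partial>M)"
  by (simp add: l2_norm_def)

lemma l2_norm_minus: "l2_norm M (\<lambda>x. f x - h x) = l2_norm M (\<lambda>x. h x - f x)"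
  by (simp add: l2_norm_def norm_minus_commute)

lemma l2_norm_cong_AE:
  assumes "f \<in> borel_measurable M" "h \<in> borel_measurable M" "AE x in M. f x = h x"
  shows "l2_norm M f = l2_norm M h"
proof -
  have "(\<integral>x. (norm (f x))\<^sup>2 \<partial>M) = (\<integral>x. (norm (h x))\<^sup>2 \<partial>M)"
    by (rule integral_cong_AE) (use assms in auto)
  then show ?thesis by (simp add: l2_norm_def)
qed

lemma l2_norm_eq_0:
  assumes "f \<in> L2_functions M"
  shows "l2_norm M f = 0 \<longleftrightarrow> (AE x in M. f x = 0)"
  using integral_nonneg_eq_0_iff_AE[OF L2_functionsD(2)[OF assms]] by (simp add: l2_norm_def)

lemma l2_norm_triangle:
  assumes f: "f \<in> L2_functions M" and h: "h \<in> L2_functions M"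
  shows "l2_norm M (\<lambda>x. f x + h x) \<le> l2_norm M f + l2_norm M h"
proof (rule field_le_epsilon)
  fix \<epsilon> :: real assume "\<epsilon> > 0"
  \<comment> \<open>Adding half of \<open>\<epsilon>\<close> keeps both weights positive when a norm
    vanishes, so that dividing by them is safe.\<close>
  define A where "A = l2_norm M f + \<epsilon> / 2"
  define B where "B = l2_norm M h + \<epsilon> / 2"
  have pos: "A > 0" "B > 0"
    using \<open>\<epsilon> > 0\<close> l2_norm_nonneg[of M f] l2_norm_nonneg[of M h] by (auto simp: A_def B_def)
  \<comment> \<open>Convexity of the square, with weights chosen so that integration gives \<open>(A + B)\<^sup>2\<close>.\<close>
  have sq: "(u + v)\<^sup>2 \<le> (A + B) * (u\<^sup>2 / A + v\<^sup>2 / B)" for u v :: real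
  proof -
    have "(A + B) * (u\<^sup>2 / A + v\<^sup>2 / B) - (u + v)\<^sup>2 = (B * u - A * v)\<^sup>2 / (A * B)"
      using pos by (simp add: field_simps power2_eq_square)
    also have "\<dots> \<ge> 0"
      using pos by simp
    finally show ?thesis by simp
  qed
  have point: "(norm (f x + h x))\<^sup>2 \<le> (A + B) * ((norm (f x))\<^sup>2 / A + (norm (h x))\<^sup>2 / B)" for x
    by (rule order_trans[OF power_mono[OF norm_triangle_ineq norm_ge_zero] sq])
  have "(l2_norm M (\<lambda>x. f x + h x))\<^sup>2
      \<le> (\<integral>x. (A + B) * ((norm (f x))\<^sup>2 / A + (norm (h x))\<^sup>2 / B) \<partial>M)"
    unfolding l2_norm_power2
    by (intro integral_mono L2_functionsD L2_functions_add f h point integrable_mult_right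
        Bochner_Integration.integrable_add integrable_divide)
  also have "\<dots> = (A + B) * ((l2_norm M f)\<^sup>2 / A + (l2_norm M h)\<^sup>2 / B)"
    unfolding l2_norm_power2 using L2_functionsD[OF f] L2_functionsD[OF h] by simp
  also have "\<dots> \<le> (A + B) * (A\<^sup>2 / A + B\<^sup>2 / B)"
    using pos \<open>\<epsilon> > 0\<close> l2_norm_nonneg
    by (intro mult_left_mono add_mono divide_right_mono power_mono) (auto simp: A_def B_def)
  also have "\<dots> = (A + B)\<^sup>2"
    using pos by (simp add: power2_eq_square)
  finally have "l2_norm M (\<lambda>x. f x + h x) \<le> A + B"
    by (rule power2_le_imp_le) (use pos in simp)
  then show "l2_norm M (\<lambda>x. f x + h x) \<le> l2_norm M f + l2_norm M h + \<epsilon>"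
    by (simp add: A_def B_def)
qed

lemma l2_norm_triangle_diff:
  assumes "f \<in> L2_functions M" "h \<in> L2_functions M" "k \<in> L2_functions M"
  shows "l2_norm M (\<lambda>x. f x - k x) \<le> l2_norm M (\<lambda>x. f x - h x) + l2_norm M (\<lambda>x. h x - k x)"
  using l2_norm_triangle[OF L2_functions_diff[OF assms(1,2)] L2_functions_diff[OF assms(2,3)]]
  by simp

text \<open>Pointwise convergence comes without a dominating function; convergence of the norms is
  enough for Fatou. It is applied below to partial sums and to tails of a series.\<close>

lemma L2_functions_Fatou:
  assumes u: "\<And>n. u n \<in> L2_functions M"
    and lim: "\<And>x. x \<in> space M \<Longrightarrow> (\<lambda>n. u n x) \<longlonglongrightarrow> F x"
    and D: "(\<lambda>n. (l2_norm M (u n))\<^sup>2) \<longlonglongrightarrow> D"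
  shows "F \<in> L2_functions M" and "(l2_norm M F)\<^sup>2 \<le> D"
proof -
  have [measurable]: "u n \<in> borel_measurable M" for n
    using u L2_functionsD by blast
  have F[measurable]: "F \<in> borel_measurable M"
    by (rule borel_measurable_LIMSEQ_metric[where f=u]) (auto simp: lim)
  have D0: "0 \<le> D"
    by (rule LIMSEQ_le_const[OF D]) auto
  have "(\<integral>\<^sup>+x. ennreal ((norm (F x))\<^sup>2) \<partial>M) = (\<integral>\<^sup>+x. liminf (\<lambda>n. ennreal ((norm (u n x))\<^sup>2)) \<partial>M)"
  proof (rule nn_integral_cong)
    fix x assume "x \<in> space M"
    then have "(\<lambda>n. ennreal ((norm (u n x))\<^sup>2)) \<longlonglongrightarrow> ennreal ((norm (F x))\<^sup>2)"
      by (intro tendsto_ennrealI tendsto_power tendsto_norm lim)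
    then show "ennreal ((norm (F x))\<^sup>2) = liminf (\<lambda>n. ennreal ((norm (u n x))\<^sup>2))"
      by (rule lim_imp_Liminf[OF sequentially_bot, symmetric])
  qed
  also have "\<dots> \<le> liminf (\<lambda>n. \<integral>\<^sup>+x. ennreal ((norm (u n x))\<^sup>2) \<partial>M)"
    by (rule nn_integral_liminf) measurable
  also have "(\<lambda>n. \<integral>\<^sup>+x. ennreal ((norm (u n x))\<^sup>2) \<partial>M) = (\<lambda>n. ennreal ((l2_norm M (u n))\<^sup>2))"
    unfolding l2_norm_power2 using L2_functionsD(2)[OF u] by (simp add: nn_integral_eq_integral)
  also have "liminf \<dots> = ennreal D"
    by (rule lim_imp_Liminf[OF sequentially_bot tendsto_ennrealI[OF D]])
  finally have le: "(\<integral>\<^sup>+x. ennreal ((norm (F x))\<^sup>2) \<partial>M) \<le> ennreal D" .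
  then have int: "integrable M (\<lambda>x. (norm (F x))\<^sup>2)"
    by (intro integrableI_bounded) (auto intro: le_less_trans)
  then show "F \<in> L2_functions M"
    by (simp add: L2_functions_def)
  show "(l2_norm M F)\<^sup>2 \<le> D"
    using le D0 unfolding l2_norm_power2 nn_integral_eq_integral[OF int, simplified] by simp
qed

text \<open>The hypothesis on \<open>s n - s m\<close> is Pythagoras for the partial sums of an orthogonal series.\<close>

lemma L2_functions_orthogonal_series:
  assumes s: "\<And>n. s n \<in> L2_functions M"
    and c: "\<And>n. (l2_norm M (s n))\<^sup>2 = c n"
    and diff: "\<And>m n. m \<le> n \<Longrightarrow> (l2_norm M (\<lambda>x. s n x - s m x))\<^sup>2 = c n - c m"
    and lim: "\<And>x. x \<in> space M \<Longrightarrow> (\<lambda>n. s n x) \<longlonglongrightarrow> F x"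
    and C: "c \<longlonglongrightarrow> C"
  shows "F \<in> L2_functions M" and "(l2_norm M F)\<^sup>2 = C"
proof -
  show F: "F \<in> L2_functions M"
    by (rule L2_functions_Fatou(1)[of s M F C, OF s lim]) (simp_all add: c C)
  have le: "(l2_norm M F)\<^sup>2 \<le> C"
    by (rule L2_functions_Fatou(2)[of s M F C, OF s lim]) (simp_all add: c C)
  \<comment> \<open>Fatou on the partial sums gives only an upper bound for the norm of
    \<open>F\<close>. Applied to the tails with \<open>m\<close> fixed, it bounds the distance from
    \<open>F\<close> to \<open>s m\<close>.\<close>
  have tail: "(l2_norm M (\<lambda>x. F x - s m x))\<^sup>2 \<le> C - c m" for m
  proof (rule L2_functions_Fatou(2)[where u="\<lambda>n x. s (n + m) x - s m x"])
    show "(\<lambda>n. s (n + m) x - s m x) \<longlonglongrightarrow> F x - s m x" if "x \<in> space M" for x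
      by (rule tendsto_diff[OF LIMSEQ_ignore_initial_segment[OF lim[OF that]] tendsto_const])
    show "(\<lambda>n. (l2_norm M (\<lambda>x. s (n + m) x - s m x))\<^sup>2) \<longlonglongrightarrow> C - c m"
      unfolding diff[OF le_add2] by (rule tendsto_diff[OF LIMSEQ_ignore_initial_segment[OF C] tendsto_const])
  qed (intro L2_functions_diff s)
  \<comment> \<open>Triangle inequality for \<open>s m\<close> as \<open>F\<close> plus
    \<open>s m - F\<close>. As \<open>m\<close> grows the tail bound vanishes, which leaves the
    missing lower bound for the norm of \<open>F\<close>.\<close>
  have "sqrt (c m) \<le> l2_norm M F + sqrt (C - c m)" for m
  proof -
    have "sqrt (c m) = l2_norm M (s m)"
      using c[of m] l2_norm_nonneg[of M "s m"] real_sqrt_unique by blast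
    also have "\<dots> \<le> l2_norm M F + l2_norm M (\<lambda>x. s m x - F x)"
      using l2_norm_triangle[OF F L2_functions_diff[OF s F], of m] by simp
    also have "l2_norm M (\<lambda>x. s m x - F x) \<le> sqrt (C - c m)"
      using tail[of m] real_le_rsqrt l2_norm_minus by metis
    finally show ?thesis by simp
  qed
  moreover have "(\<lambda>m. sqrt (c m)) \<longlonglongrightarrow> sqrt C"
    by (intro tendsto_real_sqrt C)
  moreover have "(\<lambda>m. l2_norm M F + sqrt (C - c m)) \<longlonglongrightarrow> l2_norm M F + sqrt (C - C)"
    by (intro tendsto_intros C)
  ultimately have "sqrt C \<le> l2_norm M F + sqrt (C - C)"
    by (intro LIMSEQ_le) auto
  then have "C \<le> (l2_norm M F)\<^sup>2"
    using sqrt_le_D by simp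
  with le show "(l2_norm M F)\<^sup>2 = C" by simp
qed


subsection \<open>The metric space of classes\<close>

lemma equiv_ae_rel: "equiv (L2_functions M) (ae_rel M)"
proof (rule equivI)
  show "trans (ae_rel M)"
    unfolding trans_def ae_rel_def by auto
  show "sym (ae_rel M)"
    unfolding sym_def ae_rel_def by (auto simp: eq_commute)
qed (auto simp: ae_rel_def refl_on_def)

lemma L2_class_in_L2: "f \<in> L2_functions M \<Longrightarrow> L2_class M f \<in> L2 M"
  by (simp add: L2_class_def L2_def quotientI)

lemma mem_L2_class:
  "h \<in> L2_class M f \<longleftrightarrow> f \<in> L2_functions M \<and> h \<in> L2_functions M \<and> (AE x in M. f x = h x)"
  by (auto simp: L2_class_def ae_rel_def)

lemma L2_class_eq_iff:
  assumes "f \<in> L2_functions M" "h \<in> L2_functions M"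
  shows "L2_class M f = L2_class M h \<longleftrightarrow> (AE x in M. f x = h x)"
  unfolding L2_class_def eq_equiv_class_iff[OF equiv_ae_rel assms]
  using assms by (simp add: ae_rel_def)

lemma L2_rep_class:
  assumes "f \<in> L2_functions M"
  shows "L2_rep (L2_class M f) \<in> L2_functions M" "AE x in M. L2_rep (L2_class M f) x = f x"
proof -
  have "f \<in> L2_class M f"
    using assms by (simp add: mem_L2_class)
  then have "L2_rep (L2_class M f) \<in> L2_class M f"
    unfolding L2_rep_def by (rule someI[where P="\<lambda>h. h \<in> L2_class M f"])
  then show "L2_rep (L2_class M f) \<in> L2_functions M" "AE x in M. L2_rep (L2_class M f) x = f x"
    by (auto simp: mem_L2_class eq_commute)
qed

lemma L2_obtain:
  assumes "F \<in> L2 M"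
  obtains f where "f \<in> L2_functions M" "F = L2_class M f"
  using assms unfolding L2_def L2_class_def by (auto elim: quotientE)

lemma L2_dist_class:
  assumes f: "f \<in> L2_functions M" and h: "h \<in> L2_functions M"
  shows "L2_dist M (L2_class M f) (L2_class M h) = l2_norm M (\<lambda>x. f x - h x)"
proof -
  note [measurable] = L2_functionsD(1)[OF f] L2_functionsD(1)[OF h]
    L2_functionsD(1)[OF L2_rep_class(1)[OF f]] L2_functionsD(1)[OF L2_rep_class(1)[OF h]]
  have "l2_norm M (\<lambda>x. L2_rep (L2_class M f) x - L2_rep (L2_class M h) x) = l2_norm M (\<lambda>x. f x - h x)"
    by (rule l2_norm_cong_AE) (use L2_rep_class(2)[OF f] L2_rep_class(2)[OF h] in auto)
  then show ?thesis
    by (simp add: L2_dist_def l2_norm_def)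
qed

lemma L2_inner_class:
  assumes f: "f \<in> L2_functions M" and h: "h \<in> L2_functions M"
  shows "L2_inner M (L2_class M f) (L2_class M h) = (\<integral>x. cnj (f x) * h x \<partial>M)"
proof -
  note [measurable] = L2_functionsD(1)[OF f] L2_functionsD(1)[OF h]
    L2_functionsD(1)[OF L2_rep_class(1)[OF f]] L2_functionsD(1)[OF L2_rep_class(1)[OF h]]
  show ?thesis
    unfolding L2_inner_def
    by (rule integral_cong_AE) (use L2_rep_class(2)[OF f] L2_rep_class(2)[OF h] in auto)
qed

lemma Metric_space_L2: "Metric_space (L2 M) (L2_dist M)"
proof
  show "0 \<le> L2_dist M F K" for F K
    by (simp add: L2_dist_def)
  show "L2_dist M F K = L2_dist M K F" for F K
    by (simp add: L2_dist_def norm_minus_commute)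
  show "L2_dist M F K = 0 \<longleftrightarrow> F = K" if FK: "F \<in> L2 M" "K \<in> L2 M" for F K
  proof -
    obtain f k where f: "f \<in> L2_functions M" "F = L2_class M f"
      and k: "k \<in> L2_functions M" "K = L2_class M k"
      using FK by (metis L2_obtain)
    then show ?thesis
      by (simp add: L2_dist_class l2_norm_eq_0 L2_functions_diff L2_class_eq_iff)
  qed
  show "L2_dist M F H \<le> L2_dist M F K + L2_dist M K H"
    if FKH: "F \<in> L2 M" "K \<in> L2 M" "H \<in> L2 M" for F K H
  proof -
    obtain f k h where f: "f \<in> L2_functions M" "F = L2_class M f"
      and k: "k \<in> L2_functions M" "K = L2_class M k"
      and h: "h \<in> L2_functions M" "H = L2_class M h"
      using FKH by (metis L2_obtain)
    then show ?thesis
      by (simp add: L2_dist_class l2_norm_triangle_diff)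
  qed
qed

subsection \<open>Orthogonal families\<close>

lemma (in pair_sigma_finite) has_bochner_integral_product:
  fixes f :: "'a \<Rightarrow> complex" and h :: "'b \<Rightarrow> complex"
  assumes f: "has_bochner_integral M1 f x" and h: "has_bochner_integral M2 h y"
  shows "has_bochner_integral (M1 \<Otimes>\<^sub>M M2) (\<lambda>p. f (fst p) * h (snd p)) (x * y)"
proof -
  have f': "integrable M1 f" "integral\<^sup>L M1 f = x" and h': "integrable M2 h" "integral\<^sup>L M2 h = y"
    using f h by (auto simp: has_bochner_integral_iff)
  have [measurable]: "f \<in> borel_measurable M1" "h \<in> borel_measurable M2"
    using f' h' by auto
  have int: "integrable (M1 \<Otimes>\<^sub>M M2) (\<lambda>p. f (fst p) * h (snd p))"
    by (rule Fubini_integrable) (use f' h' in \<open>auto simp: norm_mult\<close>)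
  then have "integral\<^sup>L (M1 \<Otimes>\<^sub>M M2) (\<lambda>p. f (fst p) * h (snd p)) = x * y"
    using integral_fst'[OF int] f' h' by simp
  with int show ?thesis
    by (simp add: has_bochner_integral_iff)
qed

text \<open>The squared modulus of the sum is a double sum of integrable products, of which only the
  diagonal contributes. Integrability and the value come out together.\<close>

lemma L2_functions_orthogonal_sum:
  assumes "finite S"
    and a: "\<And>p. p \<in> S \<Longrightarrow> a p \<in> borel_measurable M"
    and ort: "\<And>p q. p \<in> S \<Longrightarrow> q \<in> S \<Longrightarrow>
      has_bochner_integral M (\<lambda>x. cnj (a p x) * a q x) (if p = q then complex_of_real (w p) else 0)"
  shows "(\<lambda>x. \<Sum>p\<in>S. a p x) \<in> L2_functions M"
    and "(l2_norm M (\<lambda>x. \<Sum>p\<in>S. a p x))\<^sup>2 = (\<Sum>p\<in>S. w p)"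
proof -
  have "has_bochner_integral M (\<lambda>x. \<Sum>p\<in>S. \<Sum>q\<in>S. cnj (a p x) * a q x)
      (\<Sum>p\<in>S. \<Sum>q\<in>S. if p = q then complex_of_real (w p) else 0)"
    by (intro has_bochner_integral_sum ort)
  moreover have "(\<Sum>p\<in>S. \<Sum>q\<in>S. cnj (a p x) * a q x)
      = complex_of_real ((norm (\<Sum>p\<in>S. a p x))\<^sup>2)" for x
    by (subst complex_norm_square, subst mult.commute) (simp add: sum_product)
  moreover have "(\<Sum>p\<in>S. \<Sum>q\<in>S. if p = q then complex_of_real (w p) else 0)
      = complex_of_real (\<Sum>p\<in>S. w p)"
    using assms(1) by simp
  ultimately have "has_bochner_integral M (\<lambda>x. complex_of_real ((norm (\<Sum>p\<in>S. a p x))\<^sup>2))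
      (complex_of_real (\<Sum>p\<in>S. w p))"
    by simp
  from has_bochner_integral_bounded_linear[OF bounded_linear_Re this]
  have *: "has_bochner_integral M (\<lambda>x. (norm (\<Sum>p\<in>S. a p x))\<^sup>2) (\<Sum>p\<in>S. w p)"
    by (simp only: Re_complex_of_real)
  then show "(\<lambda>x. \<Sum>p\<in>S. a p x) \<in> L2_functions M"
    unfolding L2_functions_def using a by (auto simp: has_bochner_integral_iff)
  show "(l2_norm M (\<lambda>x. \<Sum>p\<in>S. a p x))\<^sup>2 = (\<Sum>p\<in>S. w p)"
    using * unfolding l2_norm_power2 by (simp add: has_bochner_integral_iff)
qed

lemma l2_norm_add_power2:
  assumes f: "f \<in> L2_functions M" and h: "h \<in> L2_functions M"
  shows "(l2_norm M (\<lambda>x. f x + h x))\<^sup>2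
    = (l2_norm M f)\<^sup>2 + (l2_norm M h)\<^sup>2 + 2 * Re (\<integral>x. cnj (f x) * h x \<partial>M)"
proof -
  have point: "(norm (u + v))\<^sup>2 = (norm u)\<^sup>2 + (norm v)\<^sup>2 + 2 * Re (cnj u * v)" for u v :: complex
    unfolding cmod_power2 by (simp add: power2_eq_square algebra_simps)
  have int: "integrable M (\<lambda>x. cnj (f x) * h x)"
    by (rule L2_functions_cnj_mult_integrable[OF f h])
  then have "integrable M (\<lambda>x. Re (cnj (f x) * h x))"
    "(\<integral>x. Re (cnj (f x) * h x) \<partial>M) = Re (\<integral>x. cnj (f x) * h x \<partial>M)"
    by (rule integrable_Re) (rule integral_Re[OF int])
  then show ?thesis
    unfolding l2_norm_power2 point
    using L2_functionsD(2)[OF f] L2_functionsD(2)[OF h]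
    by (simp del: times_complex.sel)
qed

text \<open>The operator counterpart of \<open>l2_norm_add_power2\<close>; comparing the two is the
  polarization step of the isometry.\<close>

lemma hs_inner_add_self:
  assumes "hilbert_schmidt A" "hilbert_schmidt B"
  shows "Re (hs_inner (\<lambda>x. A x + B x) (\<lambda>x. A x + B x))
    = Re (hs_inner A A) + Re (hs_inner B B) + 2 * Re (hs_inner A B)"
  using hs_inner_commute[OF assms(2,1)]
  by (simp add: hs_inner_add_left hs_inner_add_right hilbert_schmidt_add assms)


subsection \<open>Square integrable representations\<close>

text \<open>This collects the analytic input: sigma-finiteness for Fubini, separability for
  countable bases, and the Duflo-Moore relation with constant 1.\<close>

locale normalized_rep = sigma_finite_measure \<mu>
  for \<mu> :: "'g::topological_space measure" +
  fixes U :: "'g \<Rightarrow> 'h::chilbert_space \<Rightarrow> 'h"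
  assumes sets_\<mu>: "sets \<mu> = sets borel"
    and unitary: "\<And>g. unitary_op (U g)"
    and measurable_rep: "\<And>\<phi> \<psi>. (\<lambda>g. cinner \<phi> (U g \<psi>)) \<in> borel_measurable borel"
    and Duflo_Moore: "\<And>\<phi>1 \<phi>2 \<psi>1 \<psi>2.
        has_bochner_integral \<mu> (\<lambda>g. cinner \<phi>1 (U g \<psi>1) * cinner (U g \<psi>2) \<phi>2)
          (cinner \<phi>1 \<phi>2 * cinner \<psi>2 \<psi>1)"
    and separable: "separable_space (euclidean :: 'h topology)"
begin

sublocale pair_sigma_finite \<mu> \<mu> ..

text \<open>One matrix coefficient in each group variable. The terms of the series are those with
  \<open>x = T e\<close>, \<open>y = f\<close>, \<open>z = cadjoint A f\<close> and
  \<open>w = e\<close>.\<close>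

definition coefficient :: "'h \<Rightarrow> 'h \<Rightarrow> 'h \<Rightarrow> 'h \<Rightarrow> 'g \<times> 'g \<Rightarrow> complex" where
  "coefficient x y z w g = cinner (U (fst g) x) y * cinner z (U (snd g) w)"

lemma coefficient_measurable: "coefficient x y z w \<in> borel_measurable (\<mu> \<Otimes>\<^sub>M \<mu>)"
proof -
  have [measurable]: "(\<lambda>g. cinner \<phi> (U g \<psi>)) \<in> borel_measurable \<mu>" for \<phi> \<psi>
    using measurable_rep measurable_cong_sets[OF sets_\<mu> refl] by blast
  \<comment> \<open>Weak measurability is given with \<open>U\<close> in the second slot, so the
    first factor is treated as a conjugate.\<close>
  have "(\<lambda>g. cnj (cinner y (U (fst g) x)) * cinner z (U (snd g) w)) \<in> borel_measurable (\<mu> \<Otimes>\<^sub>M \<mu>)"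
    by measurable
  then show ?thesis
    unfolding coefficient_def[abs_def] cinner_commute[symmetric] .
qed

text \<open>Grouping the four factors by group variable, with conjugation exchanging the slots, puts
  each pair into Duflo-Moore form.\<close>

lemma coefficient_inner:
  "has_bochner_integral (\<mu> \<Otimes>\<^sub>M \<mu>) (\<lambda>g. cnj (coefficient x y z w g) * coefficient x' y' z' w' g)
    ((cinner y y' * cinner x' x) * (cinner z' z * cinner w w'))"
proof -
  have "cnj (coefficient x y z w g) * coefficient x' y' z' w' g
    = (cinner y (U (fst g) x) * cinner (U (fst g) x') y')
      * (cinner z' (U (snd g) w') * cinner (U (snd g) w) z)" for g
    unfolding coefficient_def complex_cnj_mult cinner_commute[symmetric] by simp
  then show ?thesis
    using has_bochner_integral_product[OF Duflo_Moore[of y x x' y'] Duflo_Moore[of z' w' w z]]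
    by simp
qed

lemma dequantization_L2:
  assumes T: "hilbert_schmidt T" and A: "hilbert_schmidt A"
  shows "(\<lambda>g. hs_inner (That U T g) A) \<in> L2_functions (\<mu> \<Otimes>\<^sub>M \<mu>)"
    and "(l2_norm (\<mu> \<Otimes>\<^sub>M \<mu>) (\<lambda>g. hs_inner (That U T g) A))\<^sup>2 = Re (hs_inner T T) * Re (hs_inner A A)"
proof -
  obtain E :: "'h set" where E: "is_onb E"
    using A hilbert_schmidt_onb by blast
  obtain S :: "nat \<Rightarrow> 'h set"
    where S: "\<And>n. finite (S n)" "\<And>n. S n \<subseteq> E" "incseq S" "(\<Union>n. S n) = E"
    using countable_exhaustion[OF onb_countable[OF separable E]] by blast
  \<comment> \<open>Squares, rather than arbitrary finite sets of pairs, make the sum of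
    \<open>w\<close> over \<open>P n\<close> a product of two sums, whose limits are the two
    Hilbert-Schmidt norms squared.\<close>
  define P where "P = (\<lambda>n. S n \<times> S n)"
  have P: "finite (P n)" "P n \<subseteq> E \<times> E" "incseq P" "(\<Union>n. P n) = E \<times> E" for n
  proof -
    show "finite (P n)" "P n \<subseteq> E \<times> E"
      using S(1,2) by (auto simp: P_def)
    show "incseq P"
      using S(3) unfolding incseq_def P_def by (meson Sigma_mono)
    show "(\<Union>n. P n) = E \<times> E"
    proof (intro equalityI subsetI)
      fix p assume "p \<in> E \<times> E"
      then obtain m n where "fst p \<in> S m" "snd p \<in> S n"
        using S(4) by (auto simp: mem_Times_iff)
      then have "p \<in> P (max m n)"
        using incseqD[OF S(3), of m "max m n"] incseqD[OF S(3), of n "max m n"]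
        by (auto simp: P_def mem_Times_iff)
      then show "p \<in> (\<Union>n. P n)" by blast
    qed (use S(2) in \<open>auto simp: P_def\<close>)
  qed
  define a where "a = (\<lambda>(e, f). coefficient (T e) f (cadjoint A f) e)"
  define w where "w = (\<lambda>(e, f). (norm (T e))\<^sup>2 * (norm (cadjoint A f))\<^sup>2)"
  have a_meas: "a p \<in> borel_measurable (\<mu> \<Otimes>\<^sub>M \<mu>)" for p
    using coefficient_measurable by (simp add: a_def case_prod_beta)
  \<comment> \<open>The integral over the first variable contributes \<open>cinner f f'\<close>, the
    one over the second \<open>cinner e e'\<close>. So distinct pairs are orthogonal although the
    vectors \<open>T e\<close>, or the vectors \<open>cadjoint A f\<close>, need not be.\<close>
  have ort: "has_bochner_integral (\<mu> \<Otimes>\<^sub>M \<mu>) (\<lambda>g. cnj (a p g) * a q g)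
      (if p = q then complex_of_real (w p) else 0)" if "p \<in> E \<times> E" "q \<in> E \<times> E" for p q
  proof -
    obtain e f e' f' where pq: "p = (e, f)" "q = (e', f')"
      by (metis surj_pair)
    then have "(cinner f f' * cinner (T e') (T e)) * (cinner (cadjoint A f') (cadjoint A f) * cinner e e')
      = (if p = q then complex_of_real (w p) else 0)"
      using that by (auto simp: onb_cinner[OF E] w_def cinner_self)
    then show ?thesis
      using coefficient_inner[of "T e" f "cadjoint A f" e "T e'" f' "cadjoint A f'" e']
      by (simp add: a_def pq)
  qed
  have sum: "(\<lambda>g. \<Sum>p\<in>Q. a p g) \<in> L2_functions (\<mu> \<Otimes>\<^sub>M \<mu>)"
    "(l2_norm (\<mu> \<Otimes>\<^sub>M \<mu>) (\<lambda>g. \<Sum>p\<in>Q. a p g))\<^sup>2 = (\<Sum>p\<in>Q. w p)"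
    if "finite Q" "Q \<subseteq> E \<times> E" for Q
    using L2_functions_orthogonal_sum[of Q a "\<mu> \<Otimes>\<^sub>M \<mu>" w] that a_meas ort by blast+
  have P_diff: "(\<Sum>p\<in>P n. h p) - (\<Sum>p\<in>P m. h p) = (\<Sum>p\<in>P n - P m. h p)"
    if "m \<le> n" for m n and h :: "'h \<times> 'h \<Rightarrow> 'x::ab_group_add"
    by (rule sum_diff[OF P(1) incseqD[OF P(3) that], symmetric])
  have lim: "(\<lambda>n. \<Sum>p\<in>P n. a p g) \<longlonglongrightarrow> hs_inner (That U T g) A" for g
  proof -
    have "((\<lambda>p. a p g) has_sum hs_inner (That U T g) A) (E \<times> E)"
      using hs_inner_That_has_sum[of U T A E g, OF unitary T A E]
      by (simp add: a_def coefficient_def case_prod_unfold)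
    then show ?thesis
      unfolding has_sum_def by (rule filterlim_compose[OF _ filterlim_exhaustion[OF P]])
  qed
  have "(\<lambda>n. \<Sum>p\<in>P n. w p) = (\<lambda>n. (\<Sum>e\<in>S n. (norm (T e))\<^sup>2) * (\<Sum>f\<in>S n. (norm (cadjoint A f))\<^sup>2))"
    by (simp add: w_def P_def sum_product sum.cartesian_product)
  also have "\<dots> \<longlonglongrightarrow> Re (hs_inner T T) * Re (hs_inner A A)"
    using hs_inner_self_has_sum[OF T E] hs_inner_self_cadjoint[OF A E] unfolding has_sum_def
    by (intro tendsto_mult) (rule filterlim_compose[OF _ filterlim_exhaustion[OF S]], assumption)+
  finally have w_lim: "(\<lambda>n. \<Sum>p\<in>P n. w p) \<longlonglongrightarrow> Re (hs_inner T T) * Re (hs_inner A A)" .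
  have pyth: "(l2_norm (\<mu> \<Otimes>\<^sub>M \<mu>) (\<lambda>g. (\<Sum>p\<in>P n. a p g) - (\<Sum>p\<in>P m. a p g)))\<^sup>2
      = (\<Sum>p\<in>P n. w p) - (\<Sum>p\<in>P m. w p)" if "m \<le> n" for m n
    unfolding P_diff[OF that] by (rule sum(2)) (use P in auto)
  note series = L2_functions_orthogonal_series[where s="\<lambda>n g. \<Sum>p\<in>P n. a p g",
      OF sum(1)[OF P(1,2)] sum(2)[OF P(1,2)] pyth lim w_lim]
  show "(\<lambda>g. hs_inner (That U T g) A) \<in> L2_functions (\<mu> \<Otimes>\<^sub>M \<mu>)"
    "(l2_norm (\<mu> \<Otimes>\<^sub>M \<mu>) (\<lambda>g. hs_inner (That U T g) A))\<^sup>2 = Re (hs_inner T T) * Re (hs_inner A A)"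
    by (rule series; assumption)+
qed

text \<open>Polarization: the norm identity for \<open>A + B\<close> gives the real part, and the
  real part for \<open>\<i> *\<^sub>C A\<close> gives the imaginary part.\<close>

lemma dequantization_isometry:
  assumes T: "hilbert_schmidt T" "Re (hs_inner T T) = 1"
    and A: "hilbert_schmidt A" and B: "hilbert_schmidt B"
  shows "(\<integral>g. cnj (hs_inner (That U T g) A) * hs_inner (That U T g) B \<partial>(\<mu> \<Otimes>\<^sub>M \<mu>)) = hs_inner A B"
proof -
  define D where "D = (\<lambda>A g. hs_inner (That U T g) A)"
  have Tg: "hilbert_schmidt (That U T g)" for g
    by (rule hilbert_schmidt_That[of U, OF unitary T(1)])
  have re: "Re (\<integral>g. cnj (D A g) * D B g \<partial>(\<mu> \<Otimes>\<^sub>M \<mu>)) = Re (hs_inner A B)"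
    if A: "hilbert_schmidt A" and B: "hilbert_schmidt B" for A B
  proof -
    have "D (\<lambda>x. A x + B x) = (\<lambda>g. D A g + D B g)"
      by (simp add: D_def hs_inner_add_right[OF Tg A B])
    then have "(l2_norm (\<mu> \<Otimes>\<^sub>M \<mu>) (\<lambda>g. D A g + D B g))\<^sup>2
        = Re (hs_inner (\<lambda>x. A x + B x) (\<lambda>x. A x + B x))"
      using dequantization_L2(2)[OF T(1) hilbert_schmidt_add[OF A B]] T(2) by (simp add: D_def)
    then show ?thesis
      using l2_norm_add_power2[OF dequantization_L2(1)[OF T(1) A] dequantization_L2(1)[OF T(1) B]]
        dequantization_L2(2)[OF T(1) A] dequantization_L2(2)[OF T(1) B] T(2)
        hs_inner_add_self[OF A B]
      by (simp add: D_def)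
  qed
  have "Im (\<integral>g. cnj (D A g) * D B g \<partial>(\<mu> \<Otimes>\<^sub>M \<mu>)) = Im (hs_inner A B)"
  proof -
    have "D (\<lambda>x. \<i> *\<^sub>C A x) g = \<i> * D A g" for g
      by (simp add: D_def hs_inner_scale_right[OF Tg A])
    then show ?thesis
      using re[OF hilbert_schmidt_scale[OF A, of \<i>] B]
      by (simp add: hs_inner_scale_left[OF A B] mult.assoc)
  qed
  with re[OF A B] show ?thesis
    by (simp add: D_def complex_eq_iff)
qed

text \<open>Valid at every \<open>g\<close>, since \<open>That U T g\<close> is itself
  Hilbert-Schmidt. The integrand is integrable as a product of two square integrable
  functions.\<close>

lemma reproducing_property:
  assumes T: "hilbert_schmidt T" "Re (hs_inner T T) = 1" and A: "hilbert_schmidt A"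
  shows "has_bochner_integral (\<mu> \<Otimes>\<^sub>M \<mu>) (\<lambda>g'. rep_kernel U T g g' * hs_inner (That U T g') A)
    (hs_inner (That U T g) A)"
proof -
  have Tg: "hilbert_schmidt (That U T g)" for g
    by (rule hilbert_schmidt_That[of U, OF unitary T(1)])
  have kernel: "rep_kernel U T g = (\<lambda>g'. cnj (hs_inner (That U T g') (That U T g)))"
    unfolding rep_kernel_def using hs_inner_commute[OF Tg Tg] by blast
  show ?thesis
    unfolding kernel has_bochner_integral_iff
    using L2_functions_cnj_mult_integrable[OF dequantization_L2(1)[OF T(1) Tg] dequantization_L2(1)[OF T(1) A]]
      dequantization_isometry[OF T Tg A] by blast
qed

end

subsection \<open>Completeness and closed range\<close>

text \<open>Lower semicontinuity of the Hilbert-Schmidt norm: finite partial sums pass to the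
  pointwise limit and keep the bound \<open>c\<close>. The same \<open>c\<close> bounds the
  operators uniformly, so \<open>L\<close> is bounded.\<close>

lemma hilbert_schmidt_limit:
  fixes L :: "'h::chilbert_space \<Rightarrow> 'h"
  assumes B: "\<And>n. hilbert_schmidt (B n)"
    and bound: "\<And>n. Re (hs_inner (B n) (B n)) \<le> c"
    and lim: "\<And>x. (\<lambda>n. B n x) \<longlonglongrightarrow> L x"
  shows "hilbert_schmidt L" and "Re (hs_inner L L) \<le> c"
proof -
  have c: "0 \<le> c"
    using hs_inner_self_nonneg[OF B] bound order_trans by blast
  have lin: "bounded_linear (B n)" for n
    using B hilbert_schmidt_bounded_clinear bounded_clinear_bounded_linear by blast
  have norm_L: "(norm (L x))\<^sup>2 \<le> c * (norm x)\<^sup>2" for x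
  proof (rule LIMSEQ_le_const2)
    show "(\<lambda>n. (norm (B n x))\<^sup>2) \<longlonglongrightarrow> (norm (L x))\<^sup>2"
      by (intro tendsto_power tendsto_norm lim)
    have "(norm (B n x))\<^sup>2 \<le> c * (norm x)\<^sup>2" for n
      using norm_le_hs[OF B, of n x] mult_right_mono[OF bound, of "(norm x)\<^sup>2" n] by simp
    then show "\<exists>N. \<forall>n\<ge>N. (norm (B n x))\<^sup>2 \<le> c * (norm x)\<^sup>2"
      by blast
  qed
  have clin: "bounded_clinear L"
    unfolding bounded_clinear_def
  proof (intro conjI allI bounded_linear_intro[where K="sqrt c"])
    show "L (x + y) = L x + L y" for x y
      using tendsto_add[OF lim lim, of x y] lim[of "x + y"]
      by (simp add: linear_add[OF bounded_linear.linear[OF lin]] LIMSEQ_unique)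
    show "L (r *\<^sub>R x) = r *\<^sub>R L x" for r x
      using tendsto_scaleR[OF tendsto_const lim, of r x] lim[of "r *\<^sub>R x"]
      by (simp add: linear_scale[OF bounded_linear.linear[OF lin]] LIMSEQ_unique)
    show "L (z *\<^sub>C x) = z *\<^sub>C L x" for z x
      using bounded_linear.tendsto[OF bounded_linear_scaleC_left lim, of z x] lim[of "z *\<^sub>C x"]
      by (simp add: bounded_clinear_scaleC[OF hilbert_schmidt_bounded_clinear[OF B]] LIMSEQ_unique)
    show "norm (L x) \<le> norm x * sqrt c" for x
      by (rule power2_le_imp_le) (use norm_L[of x] c in \<open>auto simp: power_mult_distrib mult.commute\<close>)
  qed
  obtain E :: "'h set" where E: "is_onb E"
    using B hilbert_schmidt_onb by blast
  have fin: "(\<Sum>e\<in>F. (norm (L e))\<^sup>2) \<le> c" if "finite F" "F \<subseteq> E" for F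
  proof (rule LIMSEQ_le_const2)
    show "(\<lambda>n. \<Sum>e\<in>F. (norm (B n e))\<^sup>2) \<longlonglongrightarrow> (\<Sum>e\<in>F. (norm (L e))\<^sup>2)"
      by (intro tendsto_sum tendsto_power tendsto_norm lim)
    have "(\<Sum>e\<in>F. (norm (B n e))\<^sup>2) \<le> c" for n
      using finite_sum_le_has_sum[OF hs_inner_self_has_sum[OF B E] that, of n] bound[of n] by simp
    then show "\<exists>N. \<forall>n\<ge>N. (\<Sum>e\<in>F. (norm (B n e))\<^sup>2) \<le> c"
      by blast
  qed
  have "(\<lambda>e. (norm (L e))\<^sup>2) summable_on E"
    by (rule nonneg_bdd_above_summable_on) (use fin in \<open>auto simp: bdd_above_def\<close>)
  then show L: "hilbert_schmidt L"
    using clin hilbert_schmidt_iff[OF E] by blast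
  show "Re (hs_inner L L) \<le> c"
    by (rule has_sum_le_finite_sums[OF hs_inner_self_has_sum[OF L E] fin])
qed

lemma hilbert_schmidt_complete:
  fixes A :: "nat \<Rightarrow> 'h::chilbert_space \<Rightarrow> 'h"
  assumes A: "\<And>n. hilbert_schmidt (A n)"
    and Cauchy: "\<And>\<epsilon>. \<epsilon> > 0 \<Longrightarrow> \<exists>N. \<forall>m\<ge>N. \<forall>n\<ge>N. hs_norm (\<lambda>x. A m x - A n x) \<le> \<epsilon>"
  obtains L where "hilbert_schmidt L"
    and "\<forall>\<epsilon>>0. \<exists>N. \<forall>n\<ge>N. hs_norm (\<lambda>x. L x - A n x) \<le> \<epsilon>"
proof -
  have diff: "hilbert_schmidt (\<lambda>x. A m x - A n x)" for m n
    by (rule hilbert_schmidt_diff[OF A A])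
  have hs_le: "hs_norm B \<le> \<epsilon> \<longleftrightarrow> Re (hs_inner B B) \<le> \<epsilon>\<^sup>2" if "0 < \<epsilon>" for \<epsilon> and B :: "'h \<Rightarrow> 'h"
    unfolding hs_norm_def using that real_sqrt_le_iff[of "Re (hs_inner B B)" "\<epsilon>\<^sup>2"] by simp
  have "convergent (\<lambda>n. A n x)" for x
  proof (rule Cauchy_convergent, unfold Cauchy_def, intro allI impI)
    fix \<epsilon> :: real assume "\<epsilon> > 0"
    \<comment> \<open>The summand 1 covers \<open>x = 0\<close> and makes the inequality
      \<open>\<delta> * norm x < \<epsilon>\<close> strict.\<close>
    define \<delta> where "\<delta> = \<epsilon> / (norm x + 1)"
    have \<delta>: "\<delta> > 0"
      unfolding \<delta>_def by (rule divide_pos_pos[OF \<open>\<epsilon> > 0\<close>]) (simp add: add_nonneg_pos)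
    have "\<delta> * (norm x + 1) = \<epsilon>"
      unfolding \<delta>_def by (rule nonzero_eq_divide_eq[THEN iffD1]) (use norm_ge_zero[of x] in linarith)+
    then have \<delta>x: "\<delta> * norm x < \<epsilon>"
      using \<delta> by (simp add: algebra_simps)
    obtain N where N: "\<And>m n. m \<ge> N \<Longrightarrow> n \<ge> N \<Longrightarrow> hs_norm (\<lambda>x. A m x - A n x) \<le> \<delta>"
      using Cauchy[OF \<delta>] by blast
    have "dist (A m x) (A n x) < \<epsilon>" if "m \<ge> N" "n \<ge> N" for m n
    proof -
      have "(norm (A m x - A n x))\<^sup>2 \<le> \<delta>\<^sup>2 * (norm x)\<^sup>2"
        using norm_le_hs[OF diff[of m n], of x] N[OF that, unfolded hs_le[OF \<delta>]]
          mult_right_mono[of _ "\<delta>\<^sup>2" "(norm x)\<^sup>2"] by (meson order_trans zero_le_power2)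
      then have "(norm (A m x - A n x))\<^sup>2 \<le> (\<delta> * norm x)\<^sup>2"
        by (simp only: power_mult_distrib)
      then have "norm (A m x - A n x) \<le> \<delta> * norm x"
        by (rule power2_le_imp_le) (use \<delta> in simp)
      with \<delta>x show ?thesis by (simp add: dist_norm)
    qed
    then show "\<exists>N. \<forall>m\<ge>N. \<forall>n\<ge>N. dist (A m x) (A n x) < \<epsilon>" by blast
  qed
  then obtain L where L: "\<And>x. (\<lambda>n. A n x) \<longlonglongrightarrow> L x"
    unfolding convergent_def by metis
  \<comment> \<open>With \<open>n\<close> fixed, \<open>L - A n\<close> is the pointwise limit of
    \<open>A m - A n\<close>. Semicontinuity thus gives membership and the norm estimate at once;
    the shift by \<open>N\<close> lets every term satisfy the bound.\<close>
  have key: "hilbert_schmidt (\<lambda>x. L x - A n x) \<and> hs_norm (\<lambda>x. L x - A n x) \<le> \<epsilon>"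
    if "\<epsilon> > 0" and N: "\<And>m. m \<ge> N \<Longrightarrow> hs_norm (\<lambda>x. A m x - A n x) \<le> \<epsilon>" for \<epsilon> N n
  proof -
    have bound: "Re (hs_inner (\<lambda>x. A (m + N) x - A n x) (\<lambda>x. A (m + N) x - A n x)) \<le> \<epsilon>\<^sup>2" for m
      using N[of "m + N"] hs_le[OF that(1)] by simp
    have "(\<lambda>m. A (m + N) x - A n x) \<longlonglongrightarrow> L x - A n x" for x
      by (rule tendsto_diff[OF LIMSEQ_ignore_initial_segment[OF L] tendsto_const])
    note limit = hilbert_schmidt_limit[OF diff bound this]
    then show ?thesis
      using hs_le[OF that(1)] by blast
  qed
  obtain N where N: "\<And>m n. m \<ge> N \<Longrightarrow> n \<ge> N \<Longrightarrow> hs_norm (\<lambda>x. A m x - A n x) \<le> 1"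
    using Cauchy[of 1] by auto
  have "hilbert_schmidt (\<lambda>x. L x - A N x)"
    using key[of 1 N N] N by simp
  from hilbert_schmidt_add[OF this A[of N]] have "hilbert_schmidt L"
    by simp
  then show thesis
  proof (rule that, intro allI impI)
    fix \<epsilon> :: real assume "\<epsilon> > 0"
    with Cauchy obtain N where N: "\<And>m n. m \<ge> N \<Longrightarrow> n \<ge> N \<Longrightarrow> hs_norm (\<lambda>x. A m x - A n x) \<le> \<epsilon>"
      by blast
    then show "\<exists>N. \<forall>n\<ge>N. hs_norm (\<lambda>x. L x - A n x) \<le> \<epsilon>"
      using key[OF \<open>\<epsilon> > 0\<close>] by blast
  qed
qed


section \<open>Closedness of the range and the reproducing formula for classes\<close>

context normalized_rep
begin

lemma L2_dist_dequantization:
  assumes T: "hilbert_schmidt T" "Re (hs_inner T T) = 1"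
    and A: "hilbert_schmidt A" and B: "hilbert_schmidt B"
  shows "L2_dist (\<mu> \<Otimes>\<^sub>M \<mu>) (dequantization \<mu> U T A) (dequantization \<mu> U T B)
    = hs_norm (\<lambda>x. A x - B x)"
proof -
  have Tg: "hilbert_schmidt (That U T g)" for g
    by (rule hilbert_schmidt_That[of U, OF unitary T(1)])
  have "(l2_norm (\<mu> \<Otimes>\<^sub>M \<mu>) (\<lambda>g. hs_inner (That U T g) A - hs_inner (That U T g) B))\<^sup>2
      = Re (hs_inner (\<lambda>x. A x - B x) (\<lambda>x. A x - B x))"
    using dequantization_L2(2)[OF T(1) hilbert_schmidt_diff[OF A B]] T(2)
    by (simp add: hs_inner_diff_right[OF Tg A B])
  then show ?thesis
    unfolding dequantization_def hs_norm_def
      L2_dist_class[OF dequantization_L2(1)[OF T(1) A] dequantization_L2(1)[OF T(1) B]]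
    by (rule real_sqrt_unique[OF _ l2_norm_nonneg, symmetric])
qed

text \<open>A sequence in the range that converges in the space of classes is Cauchy. The isometry
  pulls this back to the operators, and the transform of their limit has distance 0 from the given
  limit.\<close>

lemma closedin_range_dequantization:
  assumes T: "hilbert_schmidt T" "Re (hs_inner T T) = 1"
  shows "closedin (Metric_space.mtopology (L2 (\<mu> \<Otimes>\<^sub>M \<mu>)) (L2_dist (\<mu> \<Otimes>\<^sub>M \<mu>)))
    (dequantization \<mu> U T ` Collect hilbert_schmidt)"
proof -
  interpret L2: Metric_space "L2 (\<mu> \<Otimes>\<^sub>M \<mu>)" "L2_dist (\<mu> \<Otimes>\<^sub>M \<mu>)"
    by (rule Metric_space_L2)
  let ?D = "dequantization \<mu> U T"
  have D: "?D A \<in> L2 (\<mu> \<Otimes>\<^sub>M \<mu>)" if "hilbert_schmidt A" for A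
    unfolding dequantization_def by (rule L2_class_in_L2[OF dequantization_L2(1)[OF T(1) that]])
  show ?thesis
    unfolding L2.metric_closedin_iff_sequentially_closed
  proof (intro conjI allI impI)
    show "?D ` Collect hilbert_schmidt \<subseteq> L2 (\<mu> \<Otimes>\<^sub>M \<mu>)"
      using D by auto
    fix \<sigma> F
    assume \<sigma>F: "range \<sigma> \<subseteq> ?D ` Collect hilbert_schmidt \<and> limitin L2.mtopology \<sigma> F sequentially"
    note limD = conjunct2[OF \<sigma>F, unfolded L2.limit_metric_sequentially]
    have F: "F \<in> L2 (\<mu> \<Otimes>\<^sub>M \<mu>)"
      using limD by (rule conjunct1)
    have lim: "\<exists>N. \<forall>n\<ge>N. L2_dist (\<mu> \<Otimes>\<^sub>M \<mu>) (\<sigma> n) F < \<epsilon>" if "\<epsilon> > 0" for \<epsilon>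
      using conjunct2[OF limD, rule_format, OF that] by blast
    have "\<exists>A. hilbert_schmidt A \<and> \<sigma> n = ?D A" for n
      using \<sigma>F by (auto simp: image_subset_iff image_iff)
    then obtain A where A: "\<And>n. hilbert_schmidt (A n)" and \<sigma>: "\<And>n. \<sigma> n = ?D (A n)"
      by metis
    have Cauchy: "\<exists>N. \<forall>m\<ge>N. \<forall>n\<ge>N. hs_norm (\<lambda>x. A m x - A n x) \<le> \<epsilon>" if "\<epsilon> > 0" for \<epsilon>
    proof -
      obtain N where N: "\<And>n. n \<ge> N \<Longrightarrow> L2_dist (\<mu> \<Otimes>\<^sub>M \<mu>) (\<sigma> n) F < \<epsilon> / 2"
        using lim[OF half_gt_zero[OF \<open>\<epsilon> > 0\<close>]] by blast
      have "hs_norm (\<lambda>x. A m x - A n x) \<le> \<epsilon>" if "m \<ge> N" "n \<ge> N" for m n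
        using L2.triangle[OF D[OF A] F D[OF A], of m n] N[OF that(1)] N[OF that(2)]
          L2.commute[of F "?D (A n)"]
        unfolding \<sigma> L2_dist_dequantization[OF T A A, symmetric] by linarith
      then show ?thesis by blast
    qed
    obtain L where L: "hilbert_schmidt L"
      and conv: "\<forall>\<epsilon>>0. \<exists>N. \<forall>n\<ge>N. hs_norm (\<lambda>x. L x - A n x) \<le> \<epsilon>"
      by (rule hilbert_schmidt_complete[OF A Cauchy])
    have "L2_dist (\<mu> \<Otimes>\<^sub>M \<mu>) (?D L) F \<le> 0 + \<epsilon>" if "\<epsilon> > 0" for \<epsilon>
    proof -
      obtain N1 where N1: "\<And>n. n \<ge> N1 \<Longrightarrow> L2_dist (\<mu> \<Otimes>\<^sub>M \<mu>) (\<sigma> n) F < \<epsilon> / 2"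
        using lim[OF half_gt_zero[OF \<open>\<epsilon> > 0\<close>]] by blast
      obtain N2 where N2: "\<And>n. n \<ge> N2 \<Longrightarrow> hs_norm (\<lambda>x. L x - A n x) \<le> \<epsilon> / 2"
        using conv[rule_format, OF half_gt_zero[OF \<open>\<epsilon> > 0\<close>]] by blast
      show ?thesis
        using L2.triangle[OF D[OF L] D[OF A] F, of "max N1 N2"] N1[of "max N1 N2"] N2[of "max N1 N2"]
        unfolding \<sigma> L2_dist_dequantization[OF T L A] by simp
    qed
    then have "L2_dist (\<mu> \<Otimes>\<^sub>M \<mu>) (?D L) F \<le> 0"
      by (rule field_le_epsilon)
    then have "?D L = F"
      using L2.zero[OF D[OF L] F] L2.nonneg[of "?D L" F] by simp
    then show "F \<in> ?D ` Collect hilbert_schmidt"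
      using L by blast
  qed
qed

text \<open>Replacing the trace function by \<open>\<Phi>\<close> under the integral changes the
  integrand on a null set, for every \<open>g\<close>, and leaves the integral alone. Exceptional
  points arise only when the value outside the integral is replaced as well.\<close>

lemma reproducing_property_AE:
  assumes T: "hilbert_schmidt T" "Re (hs_inner T T) = 1" and A: "hilbert_schmidt A"
    and \<Phi>: "\<Phi> \<in> dequantization \<mu> U T A"
  shows "AE g in \<mu> \<Otimes>\<^sub>M \<mu>.
    has_bochner_integral (\<mu> \<Otimes>\<^sub>M \<mu>) (\<lambda>g'. rep_kernel U T g g' * \<Phi> g') (\<Phi> g)"
proof -
  let ?F = "\<lambda>g. hs_inner (That U T g) A"
  have Tg: "hilbert_schmidt (That U T g)" for g
    by (rule hilbert_schmidt_That[of U, OF unitary T(1)])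
  have eq: "AE g in \<mu> \<Otimes>\<^sub>M \<mu>. ?F g = \<Phi> g" and [measurable]: "\<Phi> \<in> borel_measurable (\<mu> \<Otimes>\<^sub>M \<mu>)"
    using \<Phi> by (auto simp: dequantization_def mem_L2_class L2_functionsD(1))
  have F [measurable]: "?F \<in> borel_measurable (\<mu> \<Otimes>\<^sub>M \<mu>)"
    by (rule L2_functionsD(1)[OF dequantization_L2(1)[OF T(1) A]])
  have kernel: "rep_kernel U T g = (\<lambda>g'. cnj (hs_inner (That U T g') (That U T g)))" for g
    unfolding rep_kernel_def using hs_inner_commute[OF Tg Tg] by blast
  have [measurable]: "rep_kernel U T g \<in> borel_measurable (\<mu> \<Otimes>\<^sub>M \<mu>)" for g
    unfolding kernel
    by (rule borel_measurable_cnj[OF L2_functionsD(1)[OF dequantization_L2(1)[OF T(1) Tg]]])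
  have "has_bochner_integral (\<mu> \<Otimes>\<^sub>M \<mu>) (\<lambda>g'. rep_kernel U T g g' * \<Phi> g') (?F g)" for g
  proof (rule has_bochner_integralI_AE[OF reproducing_property[OF T A]])
    show "(\<lambda>g'. rep_kernel U T g g' * \<Phi> g') \<in> borel_measurable (\<mu> \<Otimes>\<^sub>M \<mu>)"
      by measurable
    show "AE g' in \<mu> \<Otimes>\<^sub>M \<mu>. rep_kernel U T g g' * ?F g' = rep_kernel U T g g' * \<Phi> g'"
      using eq by eventually_elim simp
  qed
  with eq show ?thesis
    by (metis (mono_tags, lifting) AE_mp AE_I2)
qed

end

text \<open>Local compactness covers the group by open sets contained in compact ones, which have
  finite measure. Second countability, through Lindelof, leaves a countable subcover.\<close>

lemma left_haar_measure_sigma_finite: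
  fixes \<mu> :: "'g::{topological_group_add, t2_space, second_countable_topology} measure"
  assumes lc: "locally_compact_space (euclidean :: 'g topology)" and haar: "left_haar_measure \<mu>"
  shows "sigma_finite_measure \<mu>"
proof
  have sets: "sets \<mu> = sets borel"
    using haar by (simp add: left_haar_measure_def)
  define \<U> where "\<U> = {V :: 'g set. open V \<and> (\<exists>K. compact K \<and> V \<subseteq> K)}"
  have cover: "\<Union>\<U> = UNIV"
  proof (intro equalityI subsetI UNIV_I)
    fix x :: 'g
    obtain V K where "open V" "compact K" "x \<in> V" "V \<subseteq> K"
      using lc[unfolded locally_compact_space_def, rule_format, of x] by auto
    then show "x \<in> \<Union>\<U>"
      unfolding \<U>_def by blast
  qed
  obtain \<V> where \<V>: "\<V> \<subseteq> \<U>" "countable \<V>" "\<Union>\<V> = \<Union>\<U>"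
    using Lindelof[of \<U>] by (auto simp: \<U>_def)
  show "\<exists>\<A>. countable \<A> \<and> \<A> \<subseteq> sets \<mu> \<and> \<Union>\<A> = space \<mu> \<and> (\<forall>V\<in>\<A>. emeasure \<mu> V \<noteq> \<infinity>)"
  proof (intro exI[of _ \<V>] conjI ballI)
    show "\<V> \<subseteq> sets \<mu>"
      using \<V>(1) by (auto simp: sets \<U>_def)
    show "\<Union>\<V> = space \<mu>"
      using \<V>(3) cover sets_eq_imp_space_eq[OF sets] by simp
    fix V assume "V \<in> \<V>"
    then obtain K where K: "compact K" "V \<subseteq> K"
      using \<V>(1) by (auto simp: \<U>_def)
    then have "emeasure \<mu> V \<le> emeasure \<mu> K"
      by (intro emeasure_mono) (auto simp: sets compact_imp_closed)
    also have "emeasure \<mu> K < \<infinity>"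
      using haar K(1) by (simp add: left_haar_measure_def)
    finally show "emeasure \<mu> V \<noteq> \<infinity>" by simp
  qed (rule \<V>(2))
qed

theorem mainTheorem2:
  fixes \<mu> :: "'g::{topological_group_add, t2_space, second_countable_topology} measure"
    and U :: "'g \<Rightarrow> 'h::chilbert_space \<Rightarrow> 'h"
    and T :: "'h \<Rightarrow> 'h"
  assumes "locally_compact_space (euclidean :: 'g topology)"
    and "unimodular TYPE('g)"
    and "separable_space (euclidean :: 'h topology)"
    and "left_haar_measure \<mu>"
    and "square_integrable_rep \<mu> U"
    and "normalized_in_agreement \<mu> U"
    and "hilbert_schmidt T" and "hs_norm T = 1"
  shows "(\<forall>A. hilbert_schmidt A \<longrightarrow> dequantization \<mu> U T A \<in> L2 (\<mu> \<Otimes>\<^sub>M \<mu>)) \<and>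
         (\<forall>A B. hilbert_schmidt A \<longrightarrow> hilbert_schmidt B \<longrightarrow>
            L2_inner (\<mu> \<Otimes>\<^sub>M \<mu>) (dequantization \<mu> U T A) (dequantization \<mu> U T B) = hs_inner A B) \<and>
         closedin (Metric_space.mtopology (L2 (\<mu> \<Otimes>\<^sub>M \<mu>)) (L2_dist (\<mu> \<Otimes>\<^sub>M \<mu>)))
           (dequantization \<mu> U T ` Collect hilbert_schmidt) \<and>
         (\<forall>F \<in> dequantization \<mu> U T ` Collect hilbert_schmidt. \<forall>\<Phi> \<in> F.
            AE g in \<mu> \<Otimes>\<^sub>M \<mu>.
              has_bochner_integral (\<mu> \<Otimes>\<^sub>M \<mu>) (\<lambda>g'. rep_kernel U T g g' * \<Phi> g') (\<Phi> g))"
proof -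
  interpret sigma_finite_measure \<mu>
    by (rule left_haar_measure_sigma_finite[OF assms(1,4)])
  interpret normalized_rep \<mu> U
    by unfold_locales
      (use assms(3-6) in \<open>auto simp: left_haar_measure_def square_integrable_rep_def
        projective_rep_def normalized_in_agreement_def is_duflo_moore_number_def\<close>)
  have T: "hilbert_schmidt T" "Re (hs_inner T T) = 1"
    using assms(7,8) by (auto simp: hs_norm_def)
  note L2 = dequantization_L2(1)[OF T(1)]
  show ?thesis
  proof (intro conjI allI impI ballI)
    fix A :: "'h \<Rightarrow> 'h" assume A: "hilbert_schmidt A"
    show "dequantization \<mu> U T A \<in> L2 (\<mu> \<Otimes>\<^sub>M \<mu>)"
      unfolding dequantization_def by (rule L2_class_in_L2[OF L2[OF A]])
    fix B :: "'h \<Rightarrow> 'h" assume B: "hilbert_schmidt B"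
    show "L2_inner (\<mu> \<Otimes>\<^sub>M \<mu>) (dequantization \<mu> U T A) (dequantization \<mu> U T B) = hs_inner A B"
      unfolding dequantization_def L2_inner_class[OF L2[OF A] L2[OF B]]
      by (rule dequantization_isometry[OF T A B])
  next
    fix F \<Phi> assume "F \<in> dequantization \<mu> U T ` Collect hilbert_schmidt" "\<Phi> \<in> F"
    then show "AE g in \<mu> \<Otimes>\<^sub>M \<mu>.
        has_bochner_integral (\<mu> \<Otimes>\<^sub>M \<mu>) (\<lambda>g'. rep_kernel U T g g' * \<Phi> g') (\<Phi> g)"
      using reproducing_property_AE[OF T] by blast
  qed (rule closedin_range_dequantization[OF T])
qed

end
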